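(* Let $\mathcal{B}=\mathcal{B}^{(\bar\ell)}\cup\mathcal{B}^{(\bar\ell-1)}\cup\cdots\cup\mathcal{B}^{(1)}$ be a Jordan-Krylov basis, consisting of nonzero vectors, of $\ker f(A)^{\bar\ell}$, where $\mathcal{B}^{(\ell)}=\{\mathbf{b}\in\mathcal{B}\mid\operatorname{rank}_f\mathbf{b}=\ell\}$. Then, for $i=1,2,\ldots,d$, the following hold. 1. For each $\ell$ with $1\le\ell\le\bar\ell$, the direct sum $\bigoplus_{\mathbf{b}\in\mathcal{B}^{(\ell)}}P_A(\alpha_i,\mathbf{b})$ is spanned by Jordan chains of length $\ell$. 2. The direct sum $\bigoplus_{\mathbf{b}\in\mathcal{B}}P_A(\alpha_i,\mathbf{b})$ is the generalized eigenspace of $A$ (in $\mathbb{C}^n$) associated to the eigenvalue $\alpha_i$. 3. $\bigoplus_{\mathbf{b}\in\mathcal{B}}P_A(\mathbf{b})\simeq\mathbb{C}\otimes_K\ker f(A)^{\bar\ell}$.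
   Context: Let $K\subset\mathbb{C}$ be a subfield, $A$ an $n\times n$ matrix over $K$, $E$ the identity matrix of order $n$, and $f(\lambda)\in K[\lambda]$ a monic irreducible factor, of degree $d$, of the characteristic polynomial of $A$. Let $\alpha_1,\ldots,\alpha_d\in\mathbb{C}$ be the roots of $f$, and let $\bar\ell$ be the multiplicity of $f$ in the minimal polynomial of $A$. For $1\le\ell\le\bar\ell$, $\ker f(A)^\ell=\{\mathbf{u}\in K^n\mid f(A)^\ell\mathbf{u}=\mathbf{0}\}$, and $\ker f(A)^0=\{\mathbf{0}\}$. For nonzero $\mathbf{u}\in\ker f(A)^{\bar\ell}$, $\operatorname{rank}_f\mathbf{u}=\ell$ means $\mathbf{u}\in\ker f(A)^\ell\setminus\ker f(A)^{\ell-1}$. For $\mathbf{w}\in K^n$, $L_A(\mathbf{w})=\operatorname{span}_K\{A^k\mathbf{w}\mid k\ge0\}$. Vector spaces $V_1,\ldots,V_r$ satisfy the direct sum condition if $(V_1+\cdots+V_{i-1}+V_{i+1}+\cdots+V_r)\cap V_i=\{\mathbf{0}\}$ for all $i$. A Jordan-Krylov basis of a subspace $W\subset K^n$ is a finite subset $\mathcal{W}\subset W$ such that $W=\sum_{\mathbf{w}\in\mathcal{W}}L_A(\mathbf{w})$ and the family of spaces $L_A(\mathbf{w})$, indexed by $\mathbf{w}\in\mathcal{W}$, satisfies the direct sum condition. Let $\psi_f(\mu,\lambda)=\dfrac{f(\mu)-f(\lambda)}{\mu-\lambda}\in K[\mu,\lambda]$. For $1\le k\le\bar\ell$, $\psi_f^{(k)}(\mu,\lambda)$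 is obtained from $(\psi_f(\mu,\lambda))^k$, viewed as a polynomial in $\mu$ with coefficients in $K[\lambda]$, by replacing each coefficient with its remainder on division by $f(\lambda)$. For $\mathbf{u}$ with $\operatorname{rank}_f\mathbf{u}=\ell$ and $1\le k\le\ell$, let $\mathbf{p}^{(k)}(\lambda,\mathbf{u})=\psi_f^{(k)}(A,\lambda E)f(A)^{\ell-k}\mathbf{u}$. Define $$P_A(\alpha_i,\mathbf{u})=\operatorname{span}_{\mathbb{C}}\{\mathbf{p}^{(\ell)}(\alpha_i,\mathbf{u}),\ldots,\mathbf{p}^{(1)}(\alpha_i,\mathbf{u})\}\subset\mathbb{C}^n,\qquad P_A(\mathbf{u})=P_A(\alpha_1,\mathbf{u})\oplus\cdots\oplus P_A(\alpha_d,\mathbf{u}).$$ A Jordan chain of length $\ell$ associated to $\alpha$ is a sequence $\mathbf{x}_\ell,\ldots,\mathbf{x}_1$ in $\mathbb{C}^n$ with $\mathbf{x}_1\neq\mathbf{0}$, $(A-\alpha E)\mathbf{x}_1=\mathbf{0}$ and $(A-\alpha E)\mathbf{x}_k=\mathbf{x}_{k-1}$ for $2\le k\le\ell$. *)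

theory Defs
  imports "HOL-Analysis.Analysis" "HOL-Computational_Algebra.Computational_Algebra"
    "HOL-Library.Poly_Mapping" "HOL-Library.Set_Algebras"
begin

text \<open>
  The subfield \<open>K\<close> of the complex numbers is a field type \<open>'k\<close> with a (necessarily injective)
  ring homomorphism \<open>\<iota>\<close> into \<^typ>\<open>complex\<close>; the column space of dimension \<open>n\<close> over \<open>K\<close>
  is \<open>'k ^ 'n\<close>.
\<close>

definition field_embedding :: "('k::field \<Rightarrow> complex) \<Rightarrow> bool" where
  "field_embedding \<iota> \<longleftrightarrow>
     \<iota> 1 = 1 \<and> (\<forall>x y. \<iota> (x + y) = \<iota> x + \<iota> y) \<and> (\<forall>x y. \<iota> (x * y) = \<iota> x * \<iota> y)"

definition vec_map :: "('a \<Rightarrow> 'b) \<Rightarrow> 'a ^ 'n \<Rightarrow> 'b ^ 'n" where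
  "vec_map h v = (\<chi> i. h (v $ i))"

definition mat_map :: "('a \<Rightarrow> 'b) \<Rightarrow> 'a ^ 'n ^ 'm \<Rightarrow> 'b ^ 'n ^ 'm" where
  "mat_map h M = (\<chi> i j. h (M $ i $ j))"


subsection \<open>Matrices and polynomials\<close>

(* the power instance on vectors is componentwise, hence a separate matrix power *)
definition mat_pow :: "'a::comm_ring_1 ^ 'n ^ 'n \<Rightarrow> nat \<Rightarrow> 'a ^ 'n ^ 'n" where
  "mat_pow M k = (((**) M) ^^ k) (mat 1)"

definition poly_mat :: "'a::comm_ring_1 poly \<Rightarrow> 'a ^ 'n ^ 'n \<Rightarrow> 'a ^ 'n ^ 'n" where
  "poly_mat p M = (\<Sum>k\<le>degree p. mat (coeff p k) ** mat_pow M k)"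

definition charpoly :: "'a::comm_ring_1 ^ 'n ^ 'n \<Rightarrow> 'a poly" where
  "charpoly M = det (mat [:0, 1:] - mat_map (\<lambda>a. [:a:]) M)"

definition minpoly :: "'a::field ^ 'n ^ 'n \<Rightarrow> 'a poly" where
  "minpoly M = (THE m. lead_coeff m = 1 \<and> poly_mat m M = 0 \<and>
     (\<forall>q. q \<noteq> 0 \<and> poly_mat q M = 0 \<longrightarrow> degree m \<le> degree q))"

(* the library function multiplicity is not available on polynomials over an arbitrary field *)
definition ell_bar :: "'k::field ^ 'n ^ 'n \<Rightarrow> 'k poly \<Rightarrow> nat" where
  "ell_bar A f = (GREATEST l. f ^ l dvd minpoly A)"

definition ker_pow :: "'k::field ^ 'n ^ 'n \<Rightarrow> 'k poly \<Rightarrow> nat \<Rightarrow> ('k ^ 'n) set" where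
  "ker_pow A f l = {u. mat_pow (poly_mat f A) l *v u = 0}"

(* meaningful for nonzero u in ker_pow A f (ell_bar A f) *)
definition rank_f :: "'k::field ^ 'n ^ 'n \<Rightarrow> 'k poly \<Rightarrow> 'k ^ 'n \<Rightarrow> nat" where
  "rank_f A f u = (THE l. 1 \<le> l \<and> l \<le> ell_bar A f \<and> u \<in> ker_pow A f l - ker_pow A f (l - 1))"


subsection \<open>Direct sums and Jordan-Krylov bases\<close>

text \<open>Sums of subspaces are sums of sets in the sense of \<^theory>\<open>HOL-Library.Set_Algebras\<close>,
  in particular the empty sum is \<open>{0}\<close>.\<close>

definition direct_sum_condition :: "'i set \<Rightarrow> ('i \<Rightarrow> 'v::comm_monoid_add set) \<Rightarrow> bool" where
  "direct_sum_condition I V \<longleftrightarrow> (\<forall>i\<in>I. (\<Sum>j\<in>I - {i}. V j) \<inter> V i = {0})"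

definition krylov :: "'k::field ^ 'n ^ 'n \<Rightarrow> 'k ^ 'n \<Rightarrow> ('k ^ 'n) set" where
  "krylov A w = vec.span (range (\<lambda>k. mat_pow A k *v w))"

definition jordan_krylov_basis ::
    "'k::field ^ 'n ^ 'n \<Rightarrow> ('k ^ 'n) set \<Rightarrow> ('k ^ 'n) set \<Rightarrow> bool" where
  "jordan_krylov_basis A W B \<longleftrightarrow>
     finite B \<and> B \<subseteq> W \<and> W = (\<Sum>w\<in>B. krylov A w) \<and> direct_sum_condition B (krylov A)"


subsection \<open>The polynomials psi and the spaces P\<close>

text \<open>An element of \<open>K[\<mu>, \<lambda>]\<close> is a polynomial in \<open>\<mu>\<close> with coefficients in \<open>K[\<lambda>]\<close>:
  the outer variable is \<open>\<mu>\<close>, the inner one \<open>\<lambda>\<close>.  So the first factor below is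
  \<open>f(\<mu>)\<close>, \<open>[:f:]\<close> is \<open>f(\<lambda>)\<close>, and the divisor is \<open>\<mu> - \<lambda>\<close>.\<close>

definition psi :: "'k::field poly \<Rightarrow> 'k poly poly" where
  "psi f = (map_poly (\<lambda>c. [:c:]) f - [:f:]) div [:- [:0, 1:], 1:]"

lemma psi_times: "psi f * [:- [:0, 1:], 1:] = map_poly (\<lambda>c. [:c:]) f - [:f:]"
proof -
  have "poly (map_poly (\<lambda>c. [:c:]) f) [:0, 1:] = f"
    by (induction f) (simp_all add: map_poly_pCons)
  then have "poly (map_poly (\<lambda>c. [:c:]) f - [:f:]) [:0, 1:] = 0"
    by simp
  then have "[:- [:0, 1:], 1:] dvd map_poly (\<lambda>c. [:c:]) f - [:f:]"
    by (simp only: poly_eq_0_iff_dvd)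
  then show ?thesis
    unfolding psi_def by (rule dvd_div_mult_self)
qed

definition psi_red :: "'k::field poly \<Rightarrow> nat \<Rightarrow> 'k poly poly" where
  "psi_red f k = map_poly (\<lambda>c. c mod f) (psi f ^ k)"

text \<open>The vector \<open>p\<^sup>(\<^sup>k\<^sup>)(\<lambda>, u)\<close> with entries in \<open>K[\<lambda>]\<close>: since \<open>psi_red f k\<close> has coefficients in
  \<open>K[\<lambda>]\<close>, evaluating it at \<open>A\<close>, regarded as a matrix over \<open>K[\<lambda>]\<close>, substitutes \<open>A\<close> for \<open>\<mu>\<close> and
  \<open>\<lambda>E\<close> for \<open>\<lambda>\<close>.\<close>

definition p_vec :: "'k::field ^ 'n ^ 'n \<Rightarrow> 'k poly \<Rightarrow> nat \<Rightarrow> 'k ^ 'n \<Rightarrow> 'k poly ^ 'n" where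
  "p_vec A f k u =
     poly_mat (psi_red f k) (mat_map (\<lambda>a. [:a:]) A) *v
       vec_map (\<lambda>a. [:a:]) (mat_pow (poly_mat f A) (rank_f A f u - k) *v u)"

definition p_at ::
    "('k::field \<Rightarrow> complex) \<Rightarrow> 'k ^ 'n ^ 'n \<Rightarrow> 'k poly \<Rightarrow> nat \<Rightarrow> complex \<Rightarrow> 'k ^ 'n \<Rightarrow> complex ^ 'n" where
  "p_at \<iota> A f k \<alpha> u = vec_map (\<lambda>q. poly (map_poly \<iota> q) \<alpha>) (p_vec A f k u)"

definition P_at ::
    "('k::field \<Rightarrow> complex) \<Rightarrow> 'k ^ 'n ^ 'n \<Rightarrow> 'k poly \<Rightarrow> complex \<Rightarrow> 'k ^ 'n \<Rightarrow> (complex ^ 'n) set" where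
  "P_at \<iota> A f \<alpha> u = vec.span ((\<lambda>k. p_at \<iota> A f k \<alpha> u) ` {1..rank_f A f u})"

text \<open>Here \<open>\<alpha> 1, \<dots>, \<alpha> (degree f)\<close> are the complex roots of \<open>f\<close>.\<close>

definition P_sum ::
    "('k::field \<Rightarrow> complex) \<Rightarrow> 'k ^ 'n ^ 'n \<Rightarrow> 'k poly \<Rightarrow> (nat \<Rightarrow> complex) \<Rightarrow> 'k ^ 'n \<Rightarrow>
      (complex ^ 'n) set" where
  "P_sum \<iota> A f \<alpha> u = (\<Sum>i\<in>{1..degree f}. P_at \<iota> A f (\<alpha> i) u)"


subsection \<open>Jordan chains and generalized eigenspaces\<close>

definition jordan_chain :: "complex ^ 'n ^ 'n \<Rightarrow> complex \<Rightarrow> nat \<Rightarrow> (nat \<Rightarrow> complex ^ 'n) \<Rightarrow> bool" where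
  "jordan_chain M \<alpha> l x \<longleftrightarrow>
     x 1 \<noteq> 0 \<and> (M - mat \<alpha>) *v x 1 = 0 \<and> (\<forall>k\<in>{2..l}. (M - mat \<alpha>) *v x k = x (k - 1))"

definition gen_eigenspace :: "complex ^ 'n ^ 'n \<Rightarrow> complex \<Rightarrow> (complex ^ 'n) set" where
  "gen_eigenspace M \<alpha> = {v. \<exists>m. mat_pow (M - mat \<alpha>) m *v v = 0}"


subsection \<open>Extension of scalars\<close>

text \<open>The tensor product of the complex numbers with a \<open>K\<close>-subspace \<open>V\<close>: the free abelian group on
  the pairs \<open>(z, v)\<close> with \<open>v \<in> V\<close>, modulo the subgroup generated by the bilinearity relations.
  Its elements are cosets, which are added as sets; scalars act on the first factor.\<close>

definition tensor_free :: "('k ^ 'n) set \<Rightarrow> ((complex \<times> ('k ^ 'n)) \<Rightarrow>\<^sub>0 int) set" where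
  "tensor_free V = {x. Poly_Mapping.keys x \<subseteq> UNIV \<times> V}"

definition tensor_gens ::
    "('k::field \<Rightarrow> complex) \<Rightarrow> ('k ^ 'n) set \<Rightarrow> ((complex \<times> ('k ^ 'n)) \<Rightarrow>\<^sub>0 int) set" where
  "tensor_gens \<iota> V =
     {frag_of (y + z, v) - frag_of (y, v) - frag_of (z, v) |y z v. v \<in> V} \<union>
     {frag_of (z, v + w) - frag_of (z, v) - frag_of (z, w) |z v w. v \<in> V \<and> w \<in> V} \<union>
     {frag_of (z * \<iota> a, v) - frag_of (z, a *s v) |z a v. v \<in> V}"

definition tensor_rel ::
    "('k::field \<Rightarrow> complex) \<Rightarrow> ('k ^ 'n) set \<Rightarrow> ((complex \<times> ('k ^ 'n)) \<Rightarrow>\<^sub>0 int) set" where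
  "tensor_rel \<iota> V = module.span frag_cmul (tensor_gens \<iota> V)"

definition tensor_space ::
    "('k::field \<Rightarrow> complex) \<Rightarrow> ('k ^ 'n) set \<Rightarrow> ((complex \<times> ('k ^ 'n)) \<Rightarrow>\<^sub>0 int) set set" where
  "tensor_space \<iota> V = (\<lambda>x. {x} + tensor_rel \<iota> V) ` tensor_free V"

(* adding tensor_rel again matters only for c = 0, where the image is just {0} *)
definition tensor_scale ::
    "('k::field \<Rightarrow> complex) \<Rightarrow> ('k ^ 'n) set \<Rightarrow> complex \<Rightarrow> ((complex \<times> ('k ^ 'n)) \<Rightarrow>\<^sub>0 int) set \<Rightarrow>
      ((complex \<times> ('k ^ 'n)) \<Rightarrow>\<^sub>0 int) set" where
  "tensor_scale \<iota> V c X = frag_extend (\<lambda>(z, v). frag_of (c * z, v)) ` X + tensor_rel \<iota> V"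

definition iso_tensor ::
    "('k::field \<Rightarrow> complex) \<Rightarrow> (complex ^ 'n) set \<Rightarrow> ('k ^ 'n) set \<Rightarrow> bool" where
  "iso_tensor \<iota> S V \<longleftrightarrow>
     (\<exists>\<Phi>. bij_betw \<Phi> (tensor_space \<iota> V) S \<and>
       (\<forall>X\<in>tensor_space \<iota> V. \<forall>Y\<in>tensor_space \<iota> V. \<Phi> (X + Y) = \<Phi> X + \<Phi> Y) \<and>
       (\<forall>c. \<forall>X\<in>tensor_space \<iota> V. \<Phi> (tensor_scale \<iota> V c X) = c *s \<Phi> X))"

end

theory Submission
  imports Defs
begin

text \<open>
  Write \<open>F\<close> for \<open>f\<close> over \<open>\<complex>\<close> and \<open>F\<^sub>i = F / (x - \<alpha>\<^sub>i)\<close>.  At \<open>\<lambda> = \<alpha>\<^sub>i\<close> the polynomial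
  \<open>\<psi>\<^sub>f(\<mu>, \<lambda>)\<close> becomes \<open>F\<^sub>i(\<mu>)\<close>, so \<open>p\<^sup>(\<^sup>k\<^sup>)(\<alpha>\<^sub>i, b) = F\<^sub>i\<^bsup>k\<^esup> F\<^bsup>l-k\<^esup>(A) b\<close> with \<open>l = rank b\<close>: these
  vectors form a Jordan chain, and \<open>P\<^sub>A(\<alpha>\<^sub>i, b)\<close> consists of all \<open>(q F\<^sub>i\<^bsup>l\<^esup>)(A) b\<close> with \<open>q \<in> \<complex>[x]\<close>.
  The statements then become Bezout relations between powers of the \<open>x - \<alpha>\<^sub>j\<close> and of the \<open>F\<^sub>i\<close>,
  which are coprime since \<open>f\<close> has simple roots, together with the fact that linear independence,
  direct sums and \<open>ker f(A)\<^bsup>l\<^esup>\<close> are preserved under extension of scalars, because the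
  projections involved are defined over \<open>K\<close>.
\<close>

section \<open>Polynomials in a matrix\<close>

lemma mat_mult_left_nth: "(mat c ** M) $ i $ j = c * M $ i $ j" for c :: "'a::comm_ring_1"
  by (simp add: matrix_matrix_mult_def mat_def if_distrib[where f = "\<lambda>x. x * _"] cong: if_cong)

lemma mat_mult_commute: "mat c ** M = M ** mat c" for c :: "'a::comm_ring_1"
  by (simp add: vec_eq_iff mat_mult_left_nth)
     (simp add: matrix_matrix_mult_def mat_def if_distrib[where f = "\<lambda>x. _ * x"] mult.commute
       cong: if_cong)

lemma mat_vector_mult: "mat c *v v = c *s v" for c :: "'a::comm_ring_1"
  by (simp add: vec_eq_iff matrix_vector_mult_def mat_def if_distrib[where f = "\<lambda>x. x * _"]
      cong: if_cong)

lemma mat_add: "mat (a + b) = mat a + mat b" for a :: "'a::comm_ring_1"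
  by (simp add: vec_eq_iff mat_def)

lemma mat_zero: "mat 0 = 0"
  by (simp add: vec_eq_iff mat_def)

lemma mat_pow_0 [simp]: "mat_pow M 0 = mat 1"
  by (simp add: mat_pow_def)

lemma mat_pow_Suc: "mat_pow M (Suc k) = M ** mat_pow M k"
  by (simp add: mat_pow_def)

lemma matrix_mul_sum_right: "M ** (\<Sum>i\<in>I. N i) = (\<Sum>i\<in>I. M ** N i)"
  for M :: "'a::comm_ring_1 ^ 'n ^ 'n"
  by (induction I rule: infinite_finite_induct) (simp_all add: matrix_add_ldistrib)

lemma matrix_add_rdistrib: "(M + N) ** P = M ** P + N ** P"
  for P :: "'a::comm_ring_1 ^ 'n ^ 'm"
  by (simp add: vec_eq_iff matrix_matrix_mult_def distrib_right sum.distrib)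

lemma poly_mat_0 [simp]: "poly_mat 0 M = 0"
  by (simp add: poly_mat_def mat_zero)

text \<open>Horner recursion; it replaces the defining sum over powers in the inductions on
  polynomials that follow.\<close>

lemma poly_mat_pCons: "poly_mat (pCons a p) M = mat a + M ** poly_mat p M"
proof (cases "pCons a p = 0")
  case True
  then show ?thesis by (simp add: mat_zero)
next
  case False
  have "M ** poly_mat p M = (\<Sum>k\<le>degree p. mat (coeff p k) ** mat_pow M (Suc k))"
    unfolding poly_mat_def matrix_mul_sum_right mat_pow_Suc
    by (metis (no_types, lifting) mat_mult_commute matrix_mul_assoc)
  also have "mat a + \<dots> = (\<Sum>k\<le>Suc (degree p). mat (coeff (pCons a p) k) ** mat_pow M k)"
    by (subst sum.atMost_Suc_shift) simp
  also have "\<dots> = poly_mat (pCons a p) M"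
  \<comment> \<open>For \<open>p = 0\<close> the degree does not rise, but the extra summand at
    \<open>Suc (degree p)\<close> has coefficient 0.\<close>
  proof (cases "p = 0")
    case True
    then show ?thesis by (simp add: poly_mat_def mat_zero)
  next
    case False
    then show ?thesis by (simp only: poly_mat_def degree_pCons_eq[OF False])
  qed
  finally show ?thesis by simp
qed

lemma poly_mat_const [simp]: "poly_mat [:c:] M = mat c"
  by (simp add: poly_mat_pCons)

lemma poly_mat_1 [simp]: "poly_mat 1 M = mat 1"
  by (simp add: one_pCons)

lemma poly_mat_add: "poly_mat (p + q) M = poly_mat p M + poly_mat q M"
proof (induction p arbitrary: q)
  case (pCons a p)
  obtain b r where q: "q = pCons b r" by (cases q)
  have "poly_mat (pCons a p + q) M = mat (a + b) + M ** (poly_mat p M + poly_mat r M)"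
    by (simp add: q poly_mat_pCons pCons.IH)
  also have "\<dots> = poly_mat (pCons a p) M + poly_mat q M"
    by (simp add: q poly_mat_pCons mat_add matrix_add_ldistrib)
  finally show ?case .
qed simp

lemma poly_mat_smult: "poly_mat (smult c p) M = mat c ** poly_mat p M"
proof (induction p)
  case (pCons a p)
  have "M ** (mat c ** poly_mat p M) = mat c ** (M ** poly_mat p M)"
    by (metis mat_mult_commute matrix_mul_assoc)
  moreover have "mat (c * a) = mat c ** mat a"
    by (simp add: vec_eq_iff mat_mult_left_nth) (simp add: mat_def)
  ultimately show ?case
    by (simp add: poly_mat_pCons pCons.IH matrix_add_ldistrib)
qed simp

lemma poly_mat_mult: "poly_mat (p * q) M = poly_mat p M ** poly_mat q M"
proof (induction p)
  case (pCons a p)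
  show ?case
    by (simp add: poly_mat_pCons poly_mat_add poly_mat_smult pCons.IH matrix_add_rdistrib
        matrix_mul_assoc mat_zero)
qed simp

lemma poly_mat_minus: "poly_mat (- p) M = - poly_mat p M"
  using poly_mat_add[of p "- p" M] by (simp add: eq_neg_iff_add_eq_0 add.commute)

lemma poly_mat_diff: "poly_mat (p - q) M = poly_mat p M - poly_mat q M"
  using poly_mat_add[of p "- q" M] by (simp add: poly_mat_minus)

lemma poly_mat_sum: "poly_mat (\<Sum>i\<in>I. p i) M = (\<Sum>i\<in>I. poly_mat (p i) M)"
  by (induction I rule: infinite_finite_induct) (simp_all add: poly_mat_add)

lemma poly_mat_power: "poly_mat (p ^ k) M = mat_pow (poly_mat p M) k"
  by (induction k) (simp_all add: poly_mat_mult mat_pow_Suc)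

lemma poly_mat_linear: "poly_mat [:- a, 1:] M = M - mat a"
  by (simp add: poly_mat_pCons) (simp add: vec_eq_iff mat_def)

lemma poly_mat_monom: "poly_mat (monom 1 k) M = mat_pow M k"
  by (induction k) (simp_all add: monom_Suc poly_mat_pCons mat_pow_Suc mat_zero flip: one_pCons)

section \<open>Action of matrix polynomials on vectors\<close>

lemma poly_mat_mult_vec: "poly_mat (p * q) M *v v = poly_mat p M *v (poly_mat q M *v v)"
  by (simp add: poly_mat_mult matrix_vector_mul_assoc)

lemma poly_mat_add_vec: "poly_mat (p + q) M *v v = poly_mat p M *v v + poly_mat q M *v v"
  by (simp add: poly_mat_add matrix_vector_mult_add_rdistrib)

lemma poly_mat_smult_vec: "poly_mat (smult c p) M *v v = c *s (poly_mat p M *v v)"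
  by (simp add: poly_mat_smult mat_vector_mult flip: matrix_vector_mul_assoc)

text \<open>Polynomials in \<open>M\<close> commute, so the factor that kills \<open>v\<close> can
  be applied first.\<close>

lemma poly_mat_annihilator_mult:
  assumes "poly_mat p M *v v = 0" "p dvd q"
  shows "poly_mat q M *v v = 0"
proof -
  obtain r where "q = r * p" using assms(2) by (metis dvd_def mult.commute)
  then show ?thesis using assms(1) by (simp add: poly_mat_mult_vec)
qed


subsection \<open>Change of scalars\<close>

text \<open>Covers both the embedding \<open>\<iota>\<close> and the evaluation of
  \<open>K[\<lambda>]\<close> at a complex root, through which \<open>p_at\<close> is
  computed.\<close>

locale unital_ring_hom =
  fixes h :: "'a::comm_ring_1 \<Rightarrow> 'b::comm_ring_1"
  assumes hom_one [simp]: "h 1 = 1"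
    and hom_add: "h (x + y) = h x + h y"
    and hom_mult: "h (x * y) = h x * h y"
begin

lemma hom_zero [simp]: "h 0 = 0"
  using hom_add[of 0 0] by simp

lemma hom_minus: "h (- x) = - h x"
  using hom_add[of x "- x"] by (simp add: eq_neg_iff_add_eq_0 add.commute)

lemma hom_diff: "h (x - y) = h x - h y"
  using hom_add[of x "- y"] by (simp add: hom_minus)

lemma hom_sum: "h (sum g I) = (\<Sum>i\<in>I. h (g i))"
  by (induction I rule: infinite_finite_induct) (simp_all add: hom_add)

lemma hom_of_nat: "h (of_nat k) = of_nat k"
  by (induction k) (simp_all add: hom_add)

lemma map_poly_hom_add: "map_poly h (p + q) = map_poly h p + map_poly h q"
  by (rule poly_eqI) (simp add: coeff_map_poly hom_add)

lemma map_poly_hom_diff: "map_poly h (p - q) = map_poly h p - map_poly h q"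
  by (rule poly_eqI) (simp add: coeff_map_poly hom_diff)

lemma map_poly_hom_mult: "map_poly h (p * q) = map_poly h p * map_poly h q"
  by (rule poly_eqI) (simp add: coeff_map_poly coeff_mult hom_sum hom_mult)

lemma map_poly_hom_power: "map_poly h (p ^ k) = map_poly h p ^ k"
  by (induction k) (simp_all add: map_poly_hom_mult)

lemma unital_ring_hom_poly: "unital_ring_hom (\<lambda>q. poly (map_poly h q) a)"
  by unfold_locales (simp_all add: map_poly_hom_add map_poly_hom_mult)

lemma mat_map_hom_mult: "mat_map h (M ** N) = mat_map h M ** mat_map h N"
  by (simp add: mat_map_def matrix_matrix_mult_def vec_eq_iff hom_sum hom_mult)

lemma mat_map_hom_poly_mat: "mat_map h (poly_mat p M) = poly_mat (map_poly h p) (mat_map h M)"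
proof (induction p)
  case 0
  then show ?case by (simp add: mat_map_def vec_eq_iff)
next
  case (pCons a p)
  have "mat_map h (poly_mat (pCons a p) M) = mat (h a) + mat_map h (M ** poly_mat p M)"
    by (simp add: poly_mat_pCons) (simp add: mat_map_def mat_def vec_eq_iff hom_add)
  then show ?case
    by (simp add: map_poly_pCons poly_mat_pCons mat_map_hom_mult pCons)
qed

lemma vec_map_hom_mult: "vec_map h (M *v v) = mat_map h M *v vec_map h v"
  by (simp add: vec_map_def mat_map_def matrix_vector_mult_def vec_eq_iff hom_sum hom_mult)

lemma vec_map_hom_poly_mat:
  "vec_map h (poly_mat p M *v v) = poly_mat (map_poly h p) (mat_map h M) *v vec_map h v"
  by (simp add: vec_map_hom_mult mat_map_hom_poly_mat)

lemma vec_map_hom_add: "vec_map h (v + w) = vec_map h v + vec_map h w"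
  by (simp add: vec_map_def vec_eq_iff hom_add)

lemma vec_map_hom_scale: "vec_map h (c *s v) = h c *s vec_map h v"
  by (simp add: vec_map_def vec_eq_iff hom_mult)

lemma vec_map_hom_zero [simp]: "vec_map h 0 = 0"
  by (simp add: vec_map_def vec_eq_iff)

lemma vec_map_hom_sum: "vec_map h (sum g I) = (\<Sum>i\<in>I. vec_map h (g i))"
  by (induction I rule: infinite_finite_induct) (simp_all add: vec_map_hom_add)

end

lemma map_poly_hom_pderiv:
  fixes h :: "'a::idom \<Rightarrow> 'b::idom"
  assumes "unital_ring_hom h"
  shows "map_poly h (pderiv p) = pderiv (map_poly h p)"
proof -
  interpret unital_ring_hom h by fact
  show ?thesis
    by (rule poly_eqI) (simp add: coeff_map_poly coeff_pderiv hom_mult hom_of_nat del: of_nat_Suc)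
qed


section \<open>Coprime polynomials over a field\<close>

text \<open>Coprimality as a Bezout relation: this form is preserved by ring homomorphisms and
  becomes an identity of operators once a matrix is substituted.\<close>

definition comaximal :: "'a::comm_ring_1 \<Rightarrow> 'a \<Rightarrow> bool" where
  "comaximal p q \<longleftrightarrow> (\<exists>a b. a * p + b * q = 1)"

lemma comaximal_commute: "comaximal p q \<longleftrightarrow> comaximal q p"
  unfolding comaximal_def by (metis add.commute)

text \<open>In the product of the two Bezout relations every term except the one with
  \<open>q * r\<close> contains \<open>p\<close>.\<close>

lemma comaximal_mult_right:
  assumes "comaximal p q" "comaximal p r"
  shows "comaximal p (q * r)"
proof -
  obtain a b c d where "a * p + b * q = 1" "c * p + d * r = 1"
    using assms by (auto simp: comaximal_def)
  then have "(a * p + b * q) * (c * p + d * r) = 1" by simp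
  then have "(a * c * p + a * d * r + b * q * c) * p + (b * d) * (q * r) = 1"
    by (simp add: algebra_simps)
  then show ?thesis unfolding comaximal_def by blast
qed

lemma comaximal_power_right: "comaximal p q \<Longrightarrow> comaximal p (q ^ k)"
proof (induction k)
  case 0
  have "0 * p + 1 * 1 = 1" by simp
  then show ?case unfolding comaximal_def power_0 by blast
qed (simp add: comaximal_mult_right)

lemma comaximal_power: "comaximal p q \<Longrightarrow> comaximal (p ^ j) (q ^ k)"
  using comaximal_power_right comaximal_commute by metis

lemma comaximal_prod_right:
  "(\<And>i. i \<in> I \<Longrightarrow> comaximal p (q i)) \<Longrightarrow> comaximal p (\<Prod>i\<in>I. q i)"
proof (induction I rule: infinite_finite_induct)
  case (insert i I)
  then show ?case by (simp add: comaximal_mult_right)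
qed (use comaximal_power_right[of p _ 0] in \<open>auto simp: comaximal_def intro: exI[of _ 0]\<close>)

text \<open>Euclidean algorithm: a combination dividing \<open>q\<close> and \<open>p mod q\<close>
  also divides \<open>p\<close>.\<close>

lemma poly_bezout:
  fixes p q :: "'a::field poly"
  shows "\<exists>a b. a * p + b * q dvd p \<and> a * p + b * q dvd q"
\<comment> \<open>The measure puts \<open>q = 0\<close> below the nonzero constants, so passing from
  a constant to remainder 0 also decreases it.\<close>
proof (induction "if q = 0 then 0 else Suc (degree q)" arbitrary: p q rule: less_induct)
  case less
  show ?case
  proof (cases "q = 0")
    case True
    then show ?thesis by (intro exI[of _ 1] exI[of _ 0]) simp
  next
    case False
    have "\<exists>a b. a * q + b * (p mod q) dvd q \<and> a * q + b * (p mod q) dvd p mod q"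
      by (rule less) (use False degree_mod_less[of q p] in auto)
    then obtain a b where ab: "a * q + b * (p mod q) dvd q" "a * q + b * (p mod q) dvd p mod q"
      by blast
    then have "a * q + b * (p mod q) dvd p"
      by (metis dvd_mod_iff)
    moreover have "a * q + b * (p mod q) = b * p + (a - b * (p div q)) * q"
      by (simp add: algebra_simps flip: minus_mult_div_eq_mod)
    ultimately show ?thesis using ab(1) by metis
  qed
qed

text \<open>A common divisor of \<open>f\<close> and \<open>g\<close> is a unit or a multiple of
  \<open>f\<close>; the latter would make \<open>f\<close> divide \<open>g\<close>.\<close>

lemma irreducible_imp_comaximal:
  fixes f g :: "'a::field poly"
  assumes "irreducible f" "\<not> f dvd g"
  shows "comaximal f g"
proof -
  obtain a b where d: "a * f + b * g dvd f" "a * f + b * g dvd g"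
    using poly_bezout by blast
  have "is_unit (a * f + b * g)"
    using assms d by (metis dvd_trans irreducibleD')
  then obtain c where "1 = (a * f + b * g) * c" by (auto simp: dvd_def)
  then have "(c * a) * f + (c * b) * g = 1" by (simp add: algebra_simps)
  then show ?thesis unfolding comaximal_def by blast
qed

text \<open>Modulo the linear factor, \<open>g\<close> is congruent to the constant
  \<open>poly g a\<close>, which is invertible.\<close>

lemma comaximal_linear:
  fixes g :: "'a::field poly"
  assumes "poly g a \<noteq> 0"
  shows "comaximal [:- a, 1:] g"
proof -
  define c where "c = poly g a"
  have "[:- a, 1:] dvd g - [:c:]"
    unfolding poly_eq_0_iff_dvd[symmetric] by (simp add: c_def)
  then obtain r where r: "g - [:c:] = [:- a, 1:] * r" by (auto simp: dvd_def)
  have ring_identity: "(- i * r) * l + i * g = i * (g - l * r)" for i l :: "'a poly"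
    by (simp add: algebra_simps)
  have "[:inverse c:] * (g - [:- a, 1:] * r) = [:inverse c:] * [:c:]"
    unfolding r[symmetric] by simp
  also have "\<dots> = 1" using assms by (simp add: c_def one_pCons)
  finally have "(- [:inverse c:] * r) * [:- a, 1:] + [:inverse c:] * g = 1"
    unfolding ring_identity .
  then show ?thesis unfolding comaximal_def by blast
qed

lemma comaximal_annihilate:
  assumes "comaximal p q" "poly_mat p M *v v = 0" "poly_mat q M *v v = 0"
  shows "v = 0"
proof -
  obtain a b where "a * p + b * q = 1" using assms(1) by (auto simp: comaximal_def)
  then have "v = poly_mat (a * p + b * q) M *v v" by simp
  also have "\<dots> = 0" using assms(2,3) by (simp add: poly_mat_add_vec poly_mat_mult_vec)
  finally show ?thesis .
qed

text \<open>On the kernel of \<open>p(M)\<close> only the second Bezout term survives, so a multiple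
  of \<open>q\<close> acts there as the identity.\<close>

lemma comaximal_reproduce:
  assumes "comaximal p q" "poly_mat p M *v v = 0"
  obtains b where "poly_mat (b * q) M *v v = v"
proof -
  obtain a b where ab: "a * p + b * q = 1" using assms(1) by (auto simp: comaximal_def)
  have "v = poly_mat (a * p + b * q) M *v v" by (simp add: ab)
  also have "\<dots> = poly_mat (b * q) M *v v"
    using assms(2) by (simp add: poly_mat_add_vec poly_mat_mult_vec)
  finally show ?thesis using that by metis
qed

text \<open>Chinese remainder relation, by induction: a new factor is comaximal with the product of
  the old ones.\<close>

lemma comaximal_partition_of_unity:
  fixes p :: "'i \<Rightarrow> 'a::comm_ring_1"
  assumes "finite I" "I \<noteq> {}" "\<And>i j. i \<in> I \<Longrightarrow> j \<in> I \<Longrightarrow> i \<noteq> j \<Longrightarrow> comaximal (p i) (p j)"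
  shows "\<exists>s. (\<Sum>i\<in>I. s i * (\<Prod>j\<in>I - {i}. p j)) = 1"
  using assms
proof (induction I rule: finite_ne_induct)
  case (singleton i)
  then show ?case by (auto intro: exI[of _ "\<lambda>_. 1"])
next
  case (insert k I)
  obtain s where s: "(\<Sum>i\<in>I. s i * (\<Prod>j\<in>I - {i}. p j)) = 1"
    using insert by blast
  have "comaximal (p k) (\<Prod>j\<in>I. p j)"
    by (rule comaximal_prod_right) (use insert in auto)
  then obtain u v where uv: "u * p k + v * (\<Prod>j\<in>I. p j) = 1" by (auto simp: comaximal_def)
  \<comment> \<open>The product belonging to \<open>k\<close> omits \<open>p k\<close>, so it takes
    \<open>v\<close>; each old product gains the factor \<open>p k\<close>, so the old relation is
    multiplied by \<open>u\<close>.\<close>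
  define t where "t i = (if i = k then v else u * s i)" for i
  have *: "t i * (\<Prod>j\<in>insert k I - {i}. p j) = u * p k * (s i * (\<Prod>j\<in>I - {i}. p j))"
    if "i \<in> I" for i
  proof -
    have "insert k I - {i} = insert k (I - {i})" "i \<noteq> k" using that insert.hyps by auto
    then show ?thesis using insert.hyps by (simp add: t_def mult_ac)
  qed
  have "(\<Sum>i\<in>insert k I. t i * (\<Prod>j\<in>insert k I - {i}. p j))
      = v * (\<Prod>j\<in>I. p j) + (\<Sum>i\<in>I. u * p k * (s i * (\<Prod>j\<in>I - {i}. p j)))"
    using insert.hyps * by (simp add: t_def)
  also have "\<dots> = 1" using s uv by (simp add: add.commute flip: sum_distrib_left)
  finally show ?case by blast
qed


section \<open>Sums of subspaces\<close>

lemma subspace_sum_sets: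
  fixes V :: "'i \<Rightarrow> ('a::field ^ 'n) set"
  assumes "\<And>i. i \<in> I \<Longrightarrow> vec.subspace (V i)"
  shows "vec.subspace (\<Sum>i\<in>I. V i)"
  using assms
proof (induction I rule: infinite_finite_induct)
  case (insert i I)
  then have "vec.subspace {x + y |x y. x \<in> V i \<and> y \<in> (\<Sum>i\<in>I. V i)}"
    by (intro vec.subspace_sums) auto
  moreover have "V i + (\<Sum>i\<in>I. V i) = {x + y |x y. x \<in> V i \<and> y \<in> (\<Sum>i\<in>I. V i)}"
    by (auto simp: set_plus_def)
  ultimately show ?case using insert.hyps by simp
qed (simp_all add: set_zero)

text \<open>A decomposition over \<open>J\<close> is padded with zeros on \<open>I - J\<close>,
  whence the last assumption.\<close>

lemma sum_sets_mono:
  fixes U V :: "'i \<Rightarrow> 'v::comm_monoid_add set"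
  assumes "finite I" "J \<subseteq> I" "\<And>i. i \<in> J \<Longrightarrow> U i \<subseteq> V i" "\<And>i. i \<in> I - J \<Longrightarrow> 0 \<in> V i"
  shows "(\<Sum>i\<in>J. U i) \<subseteq> (\<Sum>i\<in>I. V i)"
proof
  fix x assume "x \<in> (\<Sum>i\<in>J. U i)"
  then obtain s where s: "x = sum s J" "\<forall>i\<in>J. s i \<in> U i"
    unfolding set_sum_alt[OF finite_subset[OF assms(2,1)]] by blast
  define t where "t i = (if i \<in> J then s i else 0)" for i
  have "x = sum t I" unfolding s(1) t_def
    using assms(1,2) by (simp add: sum.If_cases Int_absorb1)
  moreover have "\<forall>i\<in>I. t i \<in> V i" using s(2) assms(3,4) by (auto simp: t_def)
  ultimately show "x \<in> (\<Sum>i\<in>I. V i)" using assms(1) by (auto simp: set_sum_alt)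
qed

lemma sum_span:
  fixes S :: "'i \<Rightarrow> ('a::field ^ 'n) set"
  assumes "finite I"
  shows "(\<Sum>i\<in>I. vec.span (S i)) = vec.span (\<Union>i\<in>I. S i)"
  using assms
proof (induction I rule: finite_induct)
  case (insert i I)
  have "(\<Union>i\<in>insert i I. S i) = S i \<union> (\<Union>i\<in>I. S i)" by auto
  then show ?case
    using insert by (auto simp: vec.span_Un set_plus_def)
qed (simp add: set_zero)

lemma sum_sets_subset_subspace:
  fixes V :: "'i \<Rightarrow> ('a::field ^ 'n) set"
  assumes "finite I" "vec.subspace W" "\<And>i. i \<in> I \<Longrightarrow> V i \<subseteq> W"
  shows "(\<Sum>i\<in>I. V i) \<subseteq> W"
  using assms by (auto simp: set_sum_alt intro!: vec.subspace_sum)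

text \<open>Both sides of each intersection shrink, while the conditions on 0 keep it
  inside.\<close>

lemma direct_sum_condition_mono:
  fixes U V :: "'i \<Rightarrow> 'v::comm_monoid_add set"
  assumes "direct_sum_condition I V" "finite I" "J \<subseteq> I"
    and "\<And>i. i \<in> I \<Longrightarrow> 0 \<in> V i" "\<And>i. i \<in> J \<Longrightarrow> 0 \<in> U i" "\<And>i. i \<in> J \<Longrightarrow> U i \<subseteq> V i"
  shows "direct_sum_condition J U"
  unfolding direct_sum_condition_def
proof
  fix i assume i: "i \<in> J"
  have "(\<Sum>j\<in>J - {i}. U j) \<subseteq> (\<Sum>j\<in>I - {i}. V j)"
    by (rule sum_sets_mono) (use assms in auto)
  moreover have "(\<Sum>j\<in>I - {i}. V j) \<inter> V i = {0}"
    using assms(1,3) i by (auto simp: direct_sum_condition_def)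
  moreover have "0 \<in> (\<Sum>j\<in>J - {i}. U j)"
    unfolding set_sum_alt[OF finite_Diff[OF finite_subset[OF assms(3,2)]]]
    using assms(5) by (auto intro!: exI[of _ "\<lambda>_. 0"])
  ultimately show "(\<Sum>j\<in>J - {i}. U j) \<inter> U i = {0}"
    using assms(5,6) i by blast
qed

text \<open>Extend a basis of \<open>V\<close> by vectors of \<open>U\<close> to a basis of the span
  of both; \<open>G\<close> kills the first part and fixes the second. A matrix over the ground
  field can later be read over a larger one.\<close>

lemma separating_projection:
  fixes U V :: "('a::field ^ 'n) set"
  assumes "vec.subspace U" "vec.subspace V" "V \<inter> U = {0}"
  obtains G :: "'a ^ 'n ^ 'n" where "\<And>u. u \<in> U \<Longrightarrow> G *v u = u" "\<And>v. v \<in> V \<Longrightarrow> G *v v = 0"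
proof -
  obtain B where B: "B \<subseteq> V" "vec.independent B" "V \<subseteq> vec.span B"
    using vec.maximal_independent_subset by blast
  obtain C where C: "B \<subseteq> C" "C \<subseteq> V \<union> U" "vec.independent C" "V \<union> U \<subseteq> vec.span C"
    using vec.maximal_independent_subset_extend[of B "V \<union> U"] B by blast
  \<comment> \<open>A basis vector outside \<open>U\<close> would lie in \<open>V\<close>, hence in
    the span of \<open>B\<close>, against independence.\<close>
  have CU: "C - B \<subseteq> U"
  proof
    fix c assume c: "c \<in> C - B"
    show "c \<in> U"
    proof (rule ccontr)
      assume "c \<notin> U"
      then have "c \<in> vec.span B" using c C(2) B(3) by blast
      moreover have "B \<subseteq> C - {c}" using c C(1) by blast
      ultimately have "c \<in> vec.span (C - {c})" using vec.span_mono by blast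
      then show False using C(3) c vec.dependent_def by blast
    qed
  qed
  obtain g where g: "Vector_Spaces.linear (*s) (*s) g" "\<forall>x\<in>C. g x = (if x \<in> B then 0 else x)"
    using vec.linear_independent_extend[OF C(3), of "\<lambda>x. if x \<in> B then 0 else x"] by auto
  interpret g: Vector_Spaces.linear "(*s)" "(*s)" g by fact
  have g0: "g v = 0" if "v \<in> V" for v
    by (rule g.eq_0_on_span[of B]) (use that B C g in auto)
  have gid: "g u = u" if "u \<in> U" for u
  proof -
    have "u \<in> vec.span (B \<union> (C - B))"
      using that C by (auto simp: Un_absorb1)
    then obtain v w where vw: "u = v + w" "v \<in> vec.span B" "w \<in> vec.span (C - B)"
      unfolding vec.span_Un by blast
    have "v \<in> V" using vw(2) B(1) assms(2) vec.span_minimal by blast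
    moreover have w: "w \<in> U" using vw(3) CU assms(1) vec.span_minimal by blast
    \<comment> \<open>Here \<open>v = u - w\<close> lies in both subspaces.\<close>
    ultimately have "v = 0"
      using assms vec.subspace_diff[OF assms(1) that w] vw(1) by auto
    have "g w = id w"
      by (rule vec.linear_eq_on[OF g(1) _ vw(3)]) (use g(2) in \<open>auto simp: vec.linear_id simp flip: id_def\<close>)
    then show ?thesis using vw(1) \<open>v = 0\<close> by simp
  qed
  show ?thesis
    by (rule that[of "matrix g"]) (simp_all add: matrix_works[OF g(1)] g0 gid)
qed


section \<open>Cyclic subspaces\<close>

lemma matrix_sum_vector: "sum N I *v v = (\<Sum>i\<in>I. N i *v v)"
  by (induction I rule: infinite_finite_induct) (simp_all add: matrix_vector_mult_add_rdistrib)

lemma poly_mat_vec_sum: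
  "poly_mat p M *v v = (\<Sum>k\<le>degree p. coeff p k *s (mat_pow M k *v v))"
  by (simp add: poly_mat_def matrix_sum_vector mat_vector_mult flip: matrix_vector_mul_assoc)

text \<open>Used with \<open>p = 1\<close> for Krylov spaces and with a power of
  \<open>cofactor i\<close> for the spaces \<open>P_at\<close>.\<close>

lemma subspace_poly_mat_multiples:
  fixes M :: "'a::field ^ 'n ^ 'n"
  shows "vec.subspace (range (\<lambda>q. poly_mat (q * p) M *v v))"
  unfolding vec.subspace_def
proof (intro conjI ballI allI)
  show "0 \<in> range (\<lambda>q. poly_mat (q * p) M *v v)"
    by (rule range_eqI[of _ _ 0]) simp
next
  fix x y assume "x \<in> range (\<lambda>q. poly_mat (q * p) M *v v)" "y \<in> range (\<lambda>q. poly_mat (q * p) M *v v)"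
  then obtain q r where "x = poly_mat (q * p) M *v v" "y = poly_mat (r * p) M *v v" by blast
  then show "x + y \<in> range (\<lambda>q. poly_mat (q * p) M *v v)"
    by (intro range_eqI[of _ _ "q + r"]) (simp add: distrib_right poly_mat_add_vec)
next
  fix c x assume "x \<in> range (\<lambda>q. poly_mat (q * p) M *v v)"
  then obtain q where "x = poly_mat (q * p) M *v v" by blast
  then show "c *s x \<in> range (\<lambda>q. poly_mat (q * p) M *v v)"
    by (intro range_eqI[of _ _ "smult c q"]) (simp add: poly_mat_smult_vec)
qed

text \<open>The cyclic module generated by \<open>v\<close> over the polynomial ring; questions
  about Krylov spaces become polynomial arithmetic.\<close>

lemma krylov_eq: "krylov M v = range (\<lambda>q. poly_mat q M *v v)"
proof
  show "krylov M v \<subseteq> range (\<lambda>q. poly_mat q M *v v)"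
    unfolding krylov_def
  proof (rule vec.span_minimal)
    show "range (\<lambda>k. mat_pow M k *v v) \<subseteq> range (\<lambda>q. poly_mat q M *v v)"
      by (auto simp flip: poly_mat_monom)
    show "vec.subspace (range (\<lambda>q. poly_mat q M *v v))"
      using subspace_poly_mat_multiples[where p = 1] by simp
  qed
  show "range (\<lambda>q. poly_mat q M *v v) \<subseteq> krylov M v"
    unfolding krylov_def image_subset_iff poly_mat_vec_sum
    by (intro ballI vec.span_sum vec.span_scale vec.span_base rangeI)
qed

lemma subspace_krylov: "vec.subspace (krylov M v)"
  by (simp add: krylov_def)

lemma subspace_kernel: "vec.subspace {v. M *v v = 0}" for M :: "'a::field ^ 'n ^ 'm"
  by (simp add: vec.subspace_def matrix_vector_right_distrib vec.scale)

lemma ker_pow_eq: "ker_pow A f l = {u. poly_mat (f ^ l) A *v u = 0}"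
  by (simp add: ker_pow_def poly_mat_power)


section \<open>The minimal polynomial\<close>

text \<open>The vectors \<open>M^k v\<close> with \<open>k \<le> n\<close> are too many to be
  independent in dimension \<open>n\<close>. If two of them coincide, a difference of monomials
  already annihilates \<open>v\<close>, so the count is made only when they are distinct.\<close>

lemma annihilator_of_vector_exists:
  fixes M :: "'a::field ^ 'n ^ 'n"
  obtains p where "p \<noteq> 0" "poly_mat p M *v v = 0"
proof -
  define n where "n = card (cart_basis :: ('a ^ 'n) set)"
  let ?g = "\<lambda>k. mat_pow M k *v v"
  show ?thesis
  proof (cases "inj_on ?g {..n}")
    case False
    then obtain i j where "i \<noteq> j" "?g i = ?g j" by (auto simp: inj_on_def)
    moreover have "monom 1 i - monom 1 j \<noteq> (0 :: 'a poly)"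
      using \<open>i \<noteq> j\<close> by (simp add: monom_eq_iff')
    ultimately show ?thesis
      by (intro that[of "monom 1 i - monom 1 j"])
         (simp_all add: poly_mat_diff poly_mat_monom matrix_vector_mult_diff_rdistrib)
  next
    case True
    have "card (?g ` {..n}) > vec.dim (?g ` {..n})"
      using vec.dim_subset_UNIV[of "?g ` {..n}"]
      unfolding card_image[OF True] by (simp add: n_def vec.dimension_def)
    then have "vec.dependent (?g ` {..n})"
      using vec.dim_eq_card_independent by fastforce
    then obtain u where u: "\<exists>x\<in>?g ` {..n}. u x \<noteq> 0" "(\<Sum>x\<in>?g ` {..n}. u x *s x) = 0"
      using vec.dependent_finite[of "?g ` {..n}"] by auto
    define p where "p = (\<Sum>k\<le>n. monom (u (?g k)) k)"
    have coeff_p: "coeff p k = (if k \<le> n then u (?g k) else 0)" for k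
      by (simp add: p_def coeff_sum)
    have "degree p \<le> n" by (rule degree_le) (simp add: coeff_p)
    then have "poly_mat p M *v v = (\<Sum>k\<le>n. coeff p k *s ?g k)"
      unfolding poly_mat_vec_sum by (intro sum.mono_neutral_left) (auto simp: coeff_eq_0)
    also have "\<dots> = (\<Sum>k\<le>n. u (?g k) *s ?g k)" by (simp add: coeff_p)
    also have "\<dots> = 0" using u(2) by (simp add: sum.reindex[OF True])
    finally have "poly_mat p M *v v = 0" .
    moreover obtain k where "k \<le> n" "u (?g k) \<noteq> 0" using u(1) by blast
    then have "coeff p k \<noteq> 0" by (simp add: coeff_p)
    then have "p \<noteq> 0" by auto
    ultimately show ?thesis by (rule that[rotated])
  qed
qed

text \<open>The product of annihilators of the standard basis vectors kills every vector.\<close>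

lemma annihilator_exists:
  fixes M :: "'a::field ^ 'n ^ 'n"
  obtains p where "p \<noteq> 0" "poly_mat p M = 0"
proof -
  have "\<forall>i. \<exists>p. p \<noteq> 0 \<and> poly_mat p M *v axis i 1 = 0"
    using annihilator_of_vector_exists by metis
  then obtain p where p: "\<And>i. p i \<noteq> 0" "\<And>i. poly_mat (p i) M *v axis i 1 = 0" by metis
  define q where "q = (\<Prod>i\<in>UNIV. p i)"
  have q: "poly_mat q M *v axis i 1 = 0" for i
    by (rule poly_mat_annihilator_mult[OF p(2)]) (auto simp: q_def)
  have "poly_mat q M *v x = 0" for x
  proof -
    have "poly_mat q M *v (\<Sum>i\<in>UNIV. x $ i *s axis i 1) = 0"
      by (simp add: vec.sum vec.scale q)
    then show ?thesis by (simp add: basis_expansion)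
  qed
  then have "poly_mat q M = 0" by (simp add: matrix_eq)
  then show ?thesis using p(1) by (intro that[of q]) (auto simp: q_def)
qed

text \<open>The \<open>THE\<close> must be justified. For existence, an annihilator of least degree
  is made monic. For uniqueness, the leading terms of two candidates cancel, yet a nonzero
  difference would be an annihilator of no smaller degree.\<close>

lemma minpoly_props:
  fixes M :: "'a::field ^ 'n ^ 'n"
  shows "minpoly M \<noteq> 0" "poly_mat (minpoly M) M = 0"
proof -
  let ?P = "\<lambda>m. lead_coeff m = 1 \<and> poly_mat m M = 0 \<and>
     (\<forall>q. q \<noteq> 0 \<and> poly_mat q M = 0 \<longrightarrow> degree m \<le> degree q)"
  obtain a where "a \<noteq> 0 \<and> poly_mat a M = 0" using annihilator_exists[of M] by blast
  then obtain p where p: "p \<noteq> 0 \<and> poly_mat p M = 0"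
    and min: "\<And>q. q \<noteq> 0 \<and> poly_mat q M = 0 \<Longrightarrow> degree p \<le> degree q"
    using ex_has_least_nat[of "\<lambda>p. p \<noteq> 0 \<and> poly_mat p M = 0" a degree] by blast
  have smult_ann: "poly_mat (smult c p) M = 0" for c using p by (simp add: poly_mat_smult)
  have ex: "?P (smult (inverse (lead_coeff p)) p)"
    using p min smult_ann by auto
  have unique: "m = m'" if "?P m" "?P m'" for m m'
  proof (rule ccontr)
    assume "m \<noteq> m'"
    then have nz: "m - m' \<noteq> 0" by simp
    have "m \<noteq> 0" "m' \<noteq> 0" using that by (metis coeff_0 zero_neq_one)+
    then have deg: "degree m = degree m'" using that by (intro antisym) blast+
    have "degree m \<le> degree (m - m')"
      using that nz by (metis diff_self poly_mat_diff)
    moreover have "degree (m - m') \<le> degree m" using deg by (simp add: degree_diff_le)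
    ultimately have "lead_coeff (m - m') = coeff m (degree m) - coeff m' (degree m')"
      using deg by simp
    then have "lead_coeff (m - m') = 0" using that by simp
    then show False using nz by (simp only: leading_coeff_0_iff)
  qed
  have "?P (minpoly M)"
    unfolding minpoly_def by (rule theI[of ?P, OF ex]) (rule unique[OF _ ex])
  then show "poly_mat (minpoly M) M = 0" and "minpoly M \<noteq> 0"
    by (blast, metis coeff_0 zero_neq_one)
qed

lemma irreducible_degree_pos: "irreducible p \<Longrightarrow> degree p > 0" for p :: "'a::field poly"
  by (metis bot_nat_0.not_eq_extremum irreducible_def is_unit_iff_degree)

text \<open>Since \<open>f\<close> has positive degree, the exponents of its powers dividing the
  nonzero minimal polynomial are bounded, so the \<open>GREATEST\<close> is attained.\<close>

lemma minpoly_split: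
  fixes A :: "'a::field ^ 'n ^ 'n"
  assumes "irreducible f"
  obtains g where "minpoly A = f ^ ell_bar A f * g" "\<not> f dvd g"
proof -
  let ?P = "\<lambda>l. f ^ l dvd minpoly A"
  have bound: "l \<le> degree (minpoly A)" if "?P l" for l
  proof -
    have "l \<le> l * degree f" using irreducible_degree_pos[OF assms] by simp
    also have "\<dots> = degree (f ^ l)" using assms by (simp add: degree_power_eq irreducible_def)
    also have "\<dots> \<le> degree (minpoly A)" by (rule dvd_imp_degree_le[OF that minpoly_props(1)])
    finally show ?thesis .
  qed
  have "?P 0" by simp
  then have "?P (ell_bar A f)" unfolding ell_bar_def using bound by (rule GreatestI_nat)
  then obtain g where g: "minpoly A = f ^ ell_bar A f * g" by (auto simp: dvd_def)
  have "\<not> f dvd g"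
  proof
    assume "f dvd g"
    then have "?P (Suc (ell_bar A f))" unfolding g power_Suc2 by (rule mult_dvd_mono[OF dvd_refl])
    then have "Suc (ell_bar A f) \<le> ell_bar A f"
      unfolding ell_bar_def by (rule Greatest_le_nat) (rule bound)
    then show False by simp
  qed
  with g show ?thesis by (rule that)
qed

text \<open>The kernels grow with the exponent, so the least exponent whose kernel contains
  \<open>u\<close> is the only one at which \<open>u\<close> is new; this justifies the
  \<open>THE\<close>.\<close>

lemma rank_f_props:
  assumes "u \<noteq> 0" "u \<in> ker_pow A f (ell_bar A f)"
  shows "1 \<le> rank_f A f u" "rank_f A f u \<le> ell_bar A f"
    and "poly_mat (f ^ rank_f A f u) A *v u = 0"
    and "poly_mat (f ^ (rank_f A f u - 1)) A *v u \<noteq> 0"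
proof -
  let ?P = "\<lambda>l. 1 \<le> l \<and> l \<le> ell_bar A f \<and> u \<in> ker_pow A f l - ker_pow A f (l - 1)"
  have mono: "u \<in> ker_pow A f k" if "u \<in> ker_pow A f j" "j \<le> k" for j k
    using that poly_mat_annihilator_mult[OF _ le_imp_power_dvd] by (auto simp: ker_pow_eq)
  define l where "l = (LEAST l. u \<in> ker_pow A f l)"
  have l: "u \<in> ker_pow A f l" "l \<le> ell_bar A f"
    unfolding l_def using assms(2) by (auto intro: LeastI Least_le)
  have "l \<noteq> 0" using l(1) assms(1) by (auto intro!: Nat.gr0I simp: ker_pow_eq)
  moreover have "u \<notin> ker_pow A f (l - 1)"
    using not_less_Least[of "l - 1" "\<lambda>l. u \<in> ker_pow A f l"] \<open>l \<noteq> 0\<close> unfolding l_def[symmetric]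
    by simp
  ultimately have "?P l" using l by auto
  moreover have "j = k" if "?P j" "?P k" for j k
  proof (rule ccontr)
    assume "j \<noteq> k"
    then have "j \<le> k - 1 \<or> k \<le> j - 1" by linarith
    then show False using that mono by blast
  qed
  ultimately have "\<exists>!l. ?P l" by blast
  then have "?P (rank_f A f u)" unfolding rank_f_def by (rule theI')
  then show "1 \<le> rank_f A f u" "rank_f A f u \<le> ell_bar A f"
    "poly_mat (f ^ rank_f A f u) A *v u = 0"
    "poly_mat (f ^ (rank_f A f u - 1)) A *v u \<noteq> 0"
    by (auto simp: ker_pow_eq)
qed


section \<open>Extension of scalars for cyclic subspaces\<close>

locale scalar_extension = unital_ring_hom \<iota> for \<iota> :: "'k::field \<Rightarrow> complex"
begin

text \<open>A nonzero \<open>x\<close> is a unit and units go to units; hence degrees and nonzero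
  vectors survive the extension.\<close>

lemma hom_eq_0_iff [simp]: "\<iota> x = 0 \<longleftrightarrow> x = 0"
  using hom_mult[of x "inverse x"] by (cases "x = 0") auto

lemma vec_map_eq_0_iff [simp]: "vec_map \<iota> v = 0 \<longleftrightarrow> v = 0"
  by (simp add: vec_map_def vec_eq_iff)

lemma degree_map_poly_hom [simp]: "degree (map_poly \<iota> p) = degree p"
  by (simp add: degree_map_poly)

lemma mat_pow_mat_map_hom: "mat_pow (mat_map \<iota> A) k *v vec_map \<iota> v = vec_map \<iota> (mat_pow A k *v v)"
  using vec_map_hom_poly_mat[of "monom 1 k" A v] by (simp add: poly_mat_monom map_poly_monom)

text \<open>Both sides are spanned by the images of the vectors \<open>A^k b\<close>.\<close>

lemma span_image_eq_sum_krylov: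
  assumes "finite B" "W = (\<Sum>b\<in>B. krylov A b)"
  shows "vec.span (vec_map \<iota> ` W) = (\<Sum>b\<in>B. krylov (mat_map \<iota> A) (vec_map \<iota> b))"
proof
  have "vec_map \<iota> ` W \<subseteq> (\<Sum>b\<in>B. krylov (mat_map \<iota> A) (vec_map \<iota> b))"
  proof
    fix x assume "x \<in> vec_map \<iota> ` W"
    then obtain s where s: "x = vec_map \<iota> (sum s B)" "\<forall>b\<in>B. s b \<in> krylov A b"
      using assms by (auto simp: set_sum_alt)
    have "vec_map \<iota> (s b) \<in> krylov (mat_map \<iota> A) (vec_map \<iota> b)" if "b \<in> B" for b
      using s(2) that by (auto simp: krylov_eq vec_map_hom_poly_mat)
    then show "x \<in> (\<Sum>b\<in>B. krylov (mat_map \<iota> A) (vec_map \<iota> b))"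
      using assms(1) s(1) by (auto simp: set_sum_alt vec_map_hom_sum)
  qed
  then show "vec.span (vec_map \<iota> ` W) \<subseteq> (\<Sum>b\<in>B. krylov (mat_map \<iota> A) (vec_map \<iota> b))"
    by (intro vec.span_minimal subspace_sum_sets subspace_krylov)
  have "krylov (mat_map \<iota> A) (vec_map \<iota> b) \<subseteq> vec.span (vec_map \<iota> ` W)" if "b \<in> B" for b
  proof -
    have "(\<Sum>b\<in>{b}. krylov A b) \<subseteq> W" unfolding assms(2)
      by (rule sum_sets_mono) (use assms(1) that subspace_krylov vec.subspace_0 in auto)
    then have "krylov A b \<subseteq> W" by simp
    moreover have "mat_pow A k *v b \<in> krylov A b" for k
      by (simp add: krylov_def vec.span_base)
    ultimately show ?thesis
      by (subst krylov_def) (auto simp: mat_pow_mat_map_hom intro!: vec.span_mono)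
  qed
  then show "(\<Sum>b\<in>B. krylov (mat_map \<iota> A) (vec_map \<iota> b)) \<subseteq> vec.span (vec_map \<iota> ` W)"
    using assms(1) by (intro sum_sets_subset_subspace) auto
qed

text \<open>A \<open>K\<close>-linear projection onto one summand along the others has a matrix over \<open>K\<close>, which over
  \<open>\<complex>\<close> still separates the summands.\<close>

lemma direct_sum_krylov_extension:
  assumes "finite B" "direct_sum_condition B (krylov A)"
  shows "direct_sum_condition B (\<lambda>b. krylov (mat_map \<iota> A) (vec_map \<iota> b))"
  unfolding direct_sum_condition_def
proof
  fix b assume b: "b \<in> B"
  let ?V = "\<Sum>c\<in>B - {b}. krylov A c" and ?V' = "\<Sum>c\<in>B - {b}. krylov (mat_map \<iota> A) (vec_map \<iota> c)"
  have "?V \<inter> krylov A b = {0}" using assms(2) b by (simp add: direct_sum_condition_def)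
  then obtain G where G: "\<And>u. u \<in> krylov A b \<Longrightarrow> G *v u = u" "\<And>v. v \<in> ?V \<Longrightarrow> G *v v = 0"
    by (rule separating_projection[OF subspace_krylov subspace_sum_sets[OF subspace_krylov]])
       (rule that)
  have gen: "mat_pow A k *v c \<in> krylov A c" for k c
    by (simp add: krylov_def vec.span_base)
  have "krylov (mat_map \<iota> A) (vec_map \<iota> b) \<subseteq> {v. (mat_map \<iota> G - mat 1) *v v = 0}"
    unfolding krylov_def[of "mat_map \<iota> A"]
    by (intro vec.span_minimal subspace_kernel)
       (auto simp: mat_pow_mat_map_hom G gen matrix_vector_mult_diff_rdistrib
         simp flip: vec_map_hom_mult)
  moreover have "?V' \<subseteq> {v. mat_map \<iota> G *v v = 0}"
  proof (rule sum_sets_subset_subspace)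
    fix c assume c: "c \<in> B - {b}"
    have "(\<Sum>c\<in>{c}. krylov A c) \<subseteq> ?V"
      by (rule sum_sets_mono) (use assms(1) c subspace_krylov vec.subspace_0 in auto)
    then have "krylov A c \<subseteq> ?V" by simp
    then have "G *v (mat_pow A k *v c) = 0" for k using G(2) gen by blast
    then show "krylov (mat_map \<iota> A) (vec_map \<iota> c) \<subseteq> {v. mat_map \<iota> G *v v = 0}"
      unfolding krylov_def
      by (intro vec.span_minimal subspace_kernel)
         (auto simp: mat_pow_mat_map_hom simp flip: vec_map_hom_mult)
  qed (use assms(1) in \<open>auto intro: subspace_kernel\<close>)
  moreover have "0 \<in> ?V'" "0 \<in> krylov (mat_map \<iota> A) (vec_map \<iota> b)"
    by (intro vec.subspace_0 subspace_sum_sets subspace_krylov)+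
  moreover have "x = 0" if "(mat_map \<iota> G - mat 1) *v x = 0" "mat_map \<iota> G *v x = 0" for x
    using that by (simp add: matrix_vector_mult_diff_rdistrib)
  ultimately show "?V' \<inter> krylov (mat_map \<iota> A) (vec_map \<iota> b) = {0}" by blast
qed

text \<open>The vectors \<open>v, A v, \<dots>, A\<^bsup>d-1\<^esup> v\<close> are independent over \<open>K\<close>; a projection of \<open>K\<^sup>n\<close> that
  kills the first \<open>degree q\<close> of them and fixes the next one detects the leading coefficient of
  \<open>q\<close> over \<open>\<complex>\<close>.\<close>

lemma poly_mat_extension_neq_0:
  fixes A :: "'k ^ 'n ^ 'n"
  assumes "irreducible f" "poly_mat f A *v v = 0" "v \<noteq> 0"
    and "q \<noteq> 0" "degree q < degree f"
  shows "poly_mat q (mat_map \<iota> A) *v vec_map \<iota> v \<noteq> 0"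
proof -
  define m where "m = degree q"
  \<comment> \<open>A nonzero \<open>p\<close> of such low degree is not divisible by
    \<open>f\<close>, hence comaximal with it; both killing \<open>v\<close> would force
    \<open>v = 0\<close>.\<close>
  have small: "p = 0" if "poly_mat p A *v v = 0" "degree p \<le> m" for p
  proof (rule ccontr)
    assume "p \<noteq> 0"
    then have "\<not> f dvd p"
      using that(2) assms(5) dvd_imp_degree_le[of f p] by (auto simp: m_def)
    then show False
      using comaximal_annihilate[OF irreducible_imp_comaximal[OF assms(1)] assms(2) that(1)]
        assms(3) by blast
  qed
  define V where "V = vec.span ((\<lambda>k. mat_pow A k *v v) ` {..<m})"
  define U where "U = vec.span {mat_pow A m *v v}"
  \<comment> \<open>Vanishing coefficients from \<open>m\<close> on replace
    \<open>degree p < m\<close>, which the zero polynomial would violate for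
    \<open>m = 0\<close>.\<close>
  have V_poly: "\<exists>p. x = poly_mat p A *v v \<and> (\<forall>k\<ge>m. coeff p k = 0)" if "x \<in> V" for x
    using that unfolding V_def
  proof (induction rule: vec.span_induct_alt)
    case base
    then show ?case by (intro exI[of _ 0]) simp
  next
    case (step c x y)
    then obtain k p where "x = mat_pow A k *v v" "k < m" "y = poly_mat p A *v v"
      "\<forall>k\<ge>m. coeff p k = 0" by auto
    then show ?case
      by (intro exI[of _ "smult c (monom 1 k) + p"])
         (simp add: poly_mat_add_vec poly_mat_smult_vec poly_mat_monom)
  qed
  have "V \<inter> U = {0}"
  proof
    show "V \<inter> U \<subseteq> {0}"
    proof
      fix x assume "x \<in> V \<inter> U"
      then obtain c where c: "x = c *s (mat_pow A m *v v)"
        by (auto simp: U_def vec.span_singleton)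
      obtain p where "x = poly_mat p A *v v" and p: "\<forall>k\<ge>m. coeff p k = 0"
        using V_poly \<open>x \<in> V \<inter> U\<close> by blast
      with c have x: "x = c *s (mat_pow A m *v v)" "x = poly_mat p A *v v" by simp_all
      have "poly_mat (smult c (monom 1 m) - p) A *v v = 0"
        using x by (simp add: poly_mat_diff matrix_vector_mult_diff_rdistrib poly_mat_smult_vec
            poly_mat_monom)
      moreover have "degree (smult c (monom 1 m) - p) \<le> m"
        using p by (intro degree_le) auto
      ultimately have "smult c (monom 1 m) - p = 0" by (rule small)
      \<comment> \<open>The coefficient at \<open>m\<close> is \<open>c\<close>, as \<open>p\<close>
        contributes nothing there.\<close>
      then have "coeff (smult c (monom 1 m) - p) m = 0" by simp
      then have "c = 0" using p by simp
      then show "x \<in> {0}" using x by simp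
    qed
    show "{0} \<subseteq> V \<inter> U" by (simp add: V_def U_def vec.span_zero)
  qed
  then obtain G where G: "\<And>u. u \<in> U \<Longrightarrow> G *v u = u" "\<And>x. x \<in> V \<Longrightarrow> G *v x = 0"
    by (rule separating_projection[rotated 2, of V U])
       (use that in \<open>auto simp: U_def V_def\<close>)
  have "G *v (mat_pow A k *v v) = 0" if "k < m" for k
    using that by (intro G) (simp add: V_def vec.span_base)
  then have kill: "mat_map \<iota> G *v (mat_pow (mat_map \<iota> A) k *v vec_map \<iota> v) = 0" if "k < m" for k
    using that by (simp add: mat_pow_mat_map_hom flip: vec_map_hom_mult)
  have "G *v (mat_pow A m *v v) = mat_pow A m *v v"
    by (intro G) (simp add: U_def vec.span_base)
  then have fix_top: "mat_map \<iota> G *v (mat_pow (mat_map \<iota> A) m *v vec_map \<iota> v)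
      = vec_map \<iota> (mat_pow A m *v v)"
    by (simp add: mat_pow_mat_map_hom flip: vec_map_hom_mult)
  have "mat_map \<iota> G *v (poly_mat q (mat_map \<iota> A) *v vec_map \<iota> v)
      = (\<Sum>k\<le>m. coeff q k *s (mat_map \<iota> G *v (mat_pow (mat_map \<iota> A) k *v vec_map \<iota> v)))"
    by (simp add: poly_mat_vec_sum vec.sum vec.scale m_def)
  also have "\<dots> = (\<Sum>k\<in>{m}. coeff q k *s (mat_map \<iota> G *v (mat_pow (mat_map \<iota> A) k *v vec_map \<iota> v)))"
    by (rule sum.mono_neutral_right) (auto simp: kill)
  also have "\<dots> = lead_coeff q *s vec_map \<iota> (mat_pow A m *v v)"
    by (simp add: fix_top flip: m_def)
  finally have "mat_map \<iota> G *v (poly_mat q (mat_map \<iota> A) *v vec_map \<iota> v)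
      = lead_coeff q *s vec_map \<iota> (mat_pow A m *v v)" .
  moreover have "mat_pow A m *v v \<noteq> 0"
    using small[of "monom 1 m"] by (auto simp: poly_mat_monom degree_monom_eq)
  ultimately show ?thesis using assms(4) by (auto simp: vec.scale_eq_0_iff)
qed

end


section \<open>The tensor product\<close>

interpretation frag: module frag_cmul
  by unfold_locales (simp_all add: frag_cmul_distrib frag_cmul_distrib2)

text \<open>The multiplication map sending \<open>z \<otimes> v\<close> to \<open>z\<close> times
  the image of \<open>v\<close>, written on the free group; the isomorphism is what it induces on
  cosets.\<close>

definition frag_value ::
    "('k::field \<Rightarrow> complex) \<Rightarrow> ((complex \<times> ('k ^ 'n)) \<Rightarrow>\<^sub>0 int) \<Rightarrow> complex ^ 'n" where
  "frag_value \<iota> x =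
     (\<Sum>p\<in>Poly_Mapping.keys x. (of_int (poly_mapping.lookup x p) * fst p) *s vec_map \<iota> (snd p))"

text \<open>Allows two elements to be summed over a common finite support.\<close>

lemma frag_value_superset:
  assumes "finite S" "Poly_Mapping.keys x \<subseteq> S"
  shows "frag_value \<iota> x = (\<Sum>p\<in>S. (of_int (poly_mapping.lookup x p) * fst p) *s vec_map \<iota> (snd p))"
  unfolding frag_value_def using assms
  by (intro sum.mono_neutral_left) (auto simp: in_keys_iff)

lemma frag_value_diff: "frag_value \<iota> (x - y) = frag_value \<iota> x - frag_value \<iota> y"
proof -
  let ?S = "Poly_Mapping.keys x \<union> Poly_Mapping.keys y"
  have "Poly_Mapping.keys (x - y) \<subseteq> ?S" by (rule keys_diff)
  then show ?thesis
    by (simp add: frag_value_superset[of ?S] lookup_minus left_diff_distrib vec.scale_left_diff_distrib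
        sum_subtractf)
qed

lemma frag_value_0 [simp]: "frag_value \<iota> 0 = 0"
  by (simp add: frag_value_def)

lemma frag_value_add: "frag_value \<iota> (x + y) = frag_value \<iota> x + frag_value \<iota> y"
  using frag_value_diff[of \<iota> "x + y" y] by simp

lemma frag_value_sum: "frag_value \<iota> (sum g I) = (\<Sum>i\<in>I. frag_value \<iota> (g i))"
  by (induction I rule: infinite_finite_induct) (simp_all add: frag_value_add)

lemma frag_value_frag_of [simp]: "frag_value \<iota> (frag_of (z, v)) = z *s vec_map \<iota> v"
  by (simp add: frag_value_def keys_frag_of)

lemma frag_value_scale:
  "frag_value \<iota> (frag_extend (\<lambda>(z, v). frag_of (c * z, v)) x) = c *s frag_value \<iota> x"
  using subset_UNIV
  by (induction x rule: frag_induction)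
     (auto simp: frag_extend_diff frag_value_diff vec.scale_right_diff_distrib)

lemma subspace_tensor_rel: "frag.subspace (tensor_rel \<iota> V)"
  by (simp add: tensor_rel_def)

lemma tensor_gens_subset_rel: "x \<in> tensor_gens \<iota> V \<Longrightarrow> x \<in> tensor_rel \<iota> V"
  by (simp add: tensor_rel_def frag.span_base)

text \<open>Additivity in the first factor with \<open>y = z = 0\<close> leaves
  \<open>- frag_of (0, v)\<close>.\<close>

lemma tensor_rel_zero_left: "v \<in> V \<Longrightarrow> frag_of (0, v) \<in> tensor_rel \<iota> V"
proof -
  assume "v \<in> V"
  then have "frag_of (0 + 0, v) - frag_of (0, v) - frag_of (0, v) \<in> tensor_gens \<iota> V"
    unfolding tensor_gens_def by blast
  then have "- frag_of (0, v) \<in> tensor_rel \<iota> V" by (auto dest: tensor_gens_subset_rel)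
  then show ?thesis using frag.subspace_neg[OF subspace_tensor_rel] by fastforce
qed

context scalar_extension
begin

text \<open>The kernel of \<open>frag_value\<close> is a subgroup, and each generating relation
  holds after evaluation, the third because \<open>\<iota>\<close> is multiplicative.\<close>

lemma frag_value_tensor_rel: "x \<in> tensor_rel \<iota> V \<Longrightarrow> frag_value \<iota> x = 0"
proof -
  assume x: "x \<in> tensor_rel \<iota> V"
  have "frag.subspace {x. frag_value \<iota> x = 0}"
  proof (rule frag.subspaceI)
    fix c and y :: "(complex \<times> ('k ^ 'n)) \<Rightarrow>\<^sub>0 int"
    assume "y \<in> {x. frag_value \<iota> x = 0}"
    then have "frag_value \<iota> (frag_cmul c y) = 0"
      by (intro frag_closure_minus_cmul[where P = "\<lambda>x. frag_value \<iota> x = 0"])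
         (auto simp: frag_value_diff)
    then show "frag_cmul c y \<in> {x. frag_value \<iota> x = 0}" by simp
  qed (simp_all add: frag_value_add)
  moreover have "tensor_gens \<iota> V \<subseteq> {x. frag_value \<iota> x = 0}"
    by (auto simp: tensor_gens_def frag_value_diff vec_map_hom_add vec_map_hom_scale
        vec.scale_left_distrib vec.scale_right_distrib)
  ultimately show "frag_value \<iota> x = 0"
    using x frag.span_minimal unfolding tensor_rel_def by blast
qed

text \<open>A \<open>K\<close>-linear map fixing \<open>t\<close> and killing the rest of
  \<open>S\<close> has a matrix over \<open>K\<close>; its image over the complex numbers isolates
  the coefficient of \<open>t\<close>.\<close>

lemma independent_image:
  fixes S :: "('k ^ 'n) set"
  assumes "vec.independent S" "finite S" "(\<Sum>s\<in>S. c s *s vec_map \<iota> s) = 0" "t \<in> S"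
  shows "c t = 0"
proof -
  obtain g where g: "Vector_Spaces.linear (*s) (*s) g" "\<forall>s\<in>S. g s = (if s = t then t else 0)"
    using vec.linear_independent_extend[OF assms(1), of "\<lambda>s. if s = t then t else 0"] by auto
  have "0 = mat_map \<iota> (matrix g) *v (\<Sum>s\<in>S. c s *s vec_map \<iota> s)"
    by (simp add: assms(3))
  also have "\<dots> = (\<Sum>s\<in>S. c s *s vec_map \<iota> (g s))"
    by (simp add: vec.sum vec.scale matrix_works[OF g(1)] flip: vec_map_hom_mult)
  also have "\<dots> = (\<Sum>s\<in>S. if s = t then c t *s vec_map \<iota> t else 0)"
    by (rule sum.cong) (use g(2) in auto)
  also have "\<dots> = c t *s vec_map \<iota> t" using assms(2,4) by simp
  finally have "c t *s vec_map \<iota> t = 0" by simp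
  moreover have "t \<noteq> 0" using assms(1,4) vec.dependent_zero by blast
  ultimately show ?thesis by simp
qed

text \<open>The set \<open>Q\<close> of elements having such a form contains the relations and the
  pure tensors on \<open>S\<close> and is closed under differences. Induction on the span brings in
  all pure tensors, and these generate everything.\<close>

lemma tensor_normal_form:
  fixes S V :: "('k ^ 'n) set"
  assumes "finite S" "S \<subseteq> V" "V \<subseteq> vec.span S" "vec.subspace V" "x \<in> tensor_free V"
  shows "\<exists>c. x - (\<Sum>s\<in>S. frag_of (c s, s)) \<in> tensor_rel \<iota> V"
proof -
  let ?R = "tensor_rel \<iota> V"
  note R_diff = frag.subspace_diff[OF subspace_tensor_rel]
    and R_add = frag.subspace_add[OF subspace_tensor_rel]
    and R_sum = frag.subspace_sum[OF subspace_tensor_rel]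
  define Q where "Q = {x. \<exists>c. x - (\<Sum>s\<in>S. frag_of (c s, s)) \<in> ?R}"
  have Q_diff: "x - y \<in> Q" if xy: "x \<in> Q" "y \<in> Q" for x y
  proof -
    obtain c e where ce: "x - (\<Sum>s\<in>S. frag_of (c s, s)) \<in> ?R" "y - (\<Sum>s\<in>S. frag_of (e s, s)) \<in> ?R"
      using xy by (auto simp: Q_def)
    \<comment> \<open>Additivity applied to \<open>c s = (c s - e s) + e s\<close>.\<close>
    have "frag_of (c s - e s + e s, s) - frag_of (c s - e s, s) - frag_of (e s, s) \<in> ?R"
      if "s \<in> S" for s
      using that assms(2) by (intro tensor_gens_subset_rel) (unfold tensor_gens_def, blast)
    then have "(\<Sum>s\<in>S. frag_of (c s, s) - frag_of (c s - e s, s) - frag_of (e s, s)) \<in> ?R"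
      by (intro R_sum) simp
    then have "(\<Sum>s\<in>S. frag_of (c s, s)) - (\<Sum>s\<in>S. frag_of (c s - e s, s))
        - (\<Sum>s\<in>S. frag_of (e s, s)) \<in> ?R"
      by (simp add: sum_subtractf)
    from R_add[OF R_diff[OF ce] this]
    have "x - y - (\<Sum>s\<in>S. frag_of (c s - e s, s)) \<in> ?R" by (simp add: algebra_simps)
    then show ?thesis by (auto simp: Q_def intro: exI[of _ "\<lambda>s. c s - e s"])
  qed
  have R_Q: "r \<in> Q" if "r \<in> ?R" for r
  proof -
    have "(\<Sum>s\<in>S. frag_of (0, s)) \<in> ?R"
      using assms(2) by (intro R_sum tensor_rel_zero_left) auto
    then have "r - (\<Sum>s\<in>S. frag_of (0, s)) \<in> ?R" using that R_diff by blast
    then show ?thesis by (auto simp: Q_def intro: exI[of _ "\<lambda>_. 0"])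
  qed
  have Q_0: "0 \<in> Q" using R_Q frag.subspace_0[OF subspace_tensor_rel] by blast
  have Q_add: "x + y \<in> Q" if "x \<in> Q" "y \<in> Q" for x y
    using Q_diff[OF that(1) Q_diff[OF Q_0 that(2)]] by simp
  have Q_basis: "frag_of (z, s) \<in> Q" if "s \<in> S" for z s
  proof -
    let ?c = "\<lambda>t. if t = s then z else 0"
    have "(\<Sum>t\<in>S. frag_of (?c t, t)) = frag_of (z, s) + (\<Sum>t\<in>S - {s}. frag_of (0, t))"
      using assms(1) that by (subst sum.remove[of _ s]) (auto intro!: sum.cong)
    moreover have "(\<Sum>t\<in>S - {s}. frag_of (0, t)) \<in> ?R"
      using assms(2) by (intro R_sum tensor_rel_zero_left) auto
    ultimately have "frag_of (z, s) - (\<Sum>t\<in>S. frag_of (?c t, t)) \<in> ?R"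
      using frag.subspace_neg[OF subspace_tensor_rel] by fastforce
    then show ?thesis unfolding Q_def by (intro CollectI exI[of _ ?c])
  qed
  have Q_pure: "frag_of (z, v) \<in> Q" if "v \<in> V" for z v
  proof -
    have "v \<in> vec.span S" using that assms(3) by blast
    \<comment> \<open>Membership in \<open>V\<close> is carried along because the relations are
      available only for vectors of \<open>V\<close>.\<close>
    then have "v \<in> V \<and> frag_of (z, v) \<in> Q"
    proof (induction rule: vec.span_induct_alt)
      case base
      have zero: "0 \<in> V" by (rule vec.subspace_0[OF assms(4)])
      \<comment> \<open>Additivity in the second factor at 0 leaves
        \<open>- frag_of (z, 0)\<close>.\<close>
      have "frag_of (z, 0 + 0) - frag_of (z, 0) - frag_of (z, 0) \<in> ?R"
        using zero by (intro tensor_gens_subset_rel) (unfold tensor_gens_def, blast)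
      then have "0 - frag_of (z, 0) \<in> Q" using R_Q by simp
      from Q_diff[OF Q_0 this] show ?case using zero by simp
    next
      case (step a s y)
      have sV: "s \<in> V" using step assms(2) by blast
      then have asV: "a *s s \<in> V" by (rule vec.subspace_scale[OF assms(4)])
      have "frag_of (z * \<iota> a, s) - frag_of (z, a *s s) \<in> ?R"
        using sV by (intro tensor_gens_subset_rel) (unfold tensor_gens_def, blast)
      from Q_diff[OF Q_basis[OF step(1), of "z * \<iota> a"] R_Q[OF this]]
      have *: "frag_of (z, a *s s) \<in> Q" by simp
      have "frag_of (z, a *s s + y) - frag_of (z, a *s s) - frag_of (z, y) \<in> ?R"
        using asV step by (intro tensor_gens_subset_rel) (unfold tensor_gens_def, blast)
      from Q_add[OF Q_add[OF R_Q[OF this] *], of "frag_of (z, y)"]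
      have "frag_of (z, a *s s + y) \<in> Q" using step by simp
      then show ?case using asV step vec.subspace_add[OF assms(4)] by blast
    qed
    then show ?thesis by blast
  qed
  have "x \<in> Q"
    by (rule frag_induction[where S = "UNIV \<times> V" and P = "\<lambda>x. x \<in> Q"])
       (use assms(5) Q_0 Q_pure Q_diff in \<open>auto simp: tensor_free_def\<close>)
  then show ?thesis by (simp add: Q_def)
qed

text \<open>In normal form over a basis, the value combines vectors that stay independent over the
  complex numbers. All coefficients vanish, leaving tensors with first factor 0. This gives
  injectivity.\<close>

lemma frag_value_eq_0_imp_tensor_rel:
  fixes V :: "('k ^ 'n) set"
  assumes "vec.subspace V" "x \<in> tensor_free V" "frag_value \<iota> x = 0"
  shows "x \<in> tensor_rel \<iota> V"
proof -
  obtain S where S: "S \<subseteq> V" "vec.independent S" "V \<subseteq> vec.span S"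
    using vec.maximal_independent_subset by blast
  have fin: "finite S" by (rule vec.finiteI_independent[OF S(2)])
  obtain c where c: "x - (\<Sum>s\<in>S. frag_of (c s, s)) \<in> tensor_rel \<iota> V"
    using tensor_normal_form[OF fin S(1,3) assms(1,2)] by blast
  have "(\<Sum>s\<in>S. c s *s vec_map \<iota> s) = 0"
    using frag_value_tensor_rel[OF c] assms(3) by (simp add: frag_value_diff frag_value_sum)
  then have "c s = 0" if "s \<in> S" for s
    using independent_image[OF S(2) fin] that by blast
  then have "(\<Sum>s\<in>S. frag_of (c s, s)) \<in> tensor_rel \<iota> V"
    using S(1) by (intro frag.subspace_sum[OF subspace_tensor_rel]) (auto intro!: tensor_rel_zero_left)
  from frag.subspace_add[OF subspace_tensor_rel c this] show ?thesis by simp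
qed

lemma frag_value_image_tensor_free:
  "frag_value \<iota> ` tensor_free V = vec.span (vec_map \<iota> ` V)"
proof
  show "frag_value \<iota> ` tensor_free V \<subseteq> vec.span (vec_map \<iota> ` V)"
    unfolding image_subset_iff frag_value_def
    by (intro ballI vec.span_sum vec.span_scale vec.span_base) (auto simp: tensor_free_def)
  show "vec.span (vec_map \<iota> ` V) \<subseteq> frag_value \<iota> ` tensor_free V"
  proof
    fix x assume "x \<in> vec.span (vec_map \<iota> ` V)"
    then show "x \<in> frag_value \<iota> ` tensor_free V"
    proof (induction rule: vec.span_induct_alt)
      case base
      then show ?case by (intro image_eqI[of _ _ 0]) (simp_all add: tensor_free_def)
    next
      case (step c x y)
      then obtain v u where v: "x = vec_map \<iota> v" "v \<in> V" and u: "y = frag_value \<iota> u" "u \<in> tensor_free V"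
        by blast
      have "Poly_Mapping.keys (frag_of (c, v) + u) \<subseteq> UNIV \<times> V"
        using Poly_Mapping.keys_add[of "frag_of (c, v)" u] u(2) v(2)
        by (auto simp: tensor_free_def keys_frag_of)
      then show ?case
        using v u by (intro image_eqI[of _ _ "frag_of (c, v) + u"])
          (simp_all add: tensor_free_def frag_value_add)
    qed
  qed
qed

text \<open>By the preceding lemmas \<open>frag_value\<close> is constant on cosets, separates them,
  and has the span as its image.\<close>

lemma iso_tensor_span:
  fixes V :: "('k ^ 'n) set"
  assumes V: "vec.subspace V"
  shows "iso_tensor \<iota> (vec.span (vec_map \<iota> ` V)) V"
proof -
  let ?R = "tensor_rel \<iota> V"
  define \<Phi> where "\<Phi> X = the_elem (frag_value \<iota> ` X)" for X :: "((complex \<times> ('k ^ 'n)) \<Rightarrow>\<^sub>0 int) set"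
  have R_0: "0 \<in> ?R" by (rule frag.subspace_0[OF subspace_tensor_rel])
  have R_R: "?R + ?R = ?R"
  proof
    show "?R + ?R \<subseteq> ?R"
      by (auto elim!: set_plus_elim intro: frag.subspace_add[OF subspace_tensor_rel])
    show "?R \<subseteq> ?R + ?R" using set_plus_intro[OF R_0] by fastforce
  qed
  have coset_R: "{r} + ?R = ?R" if "r \<in> ?R" for r
  proof
    show "{r} + ?R \<subseteq> ?R" using that R_R set_plus_mono2[of "{r}" ?R ?R ?R] by simp
    show "?R \<subseteq> {r} + ?R"
    proof
      fix s assume "s \<in> ?R"
      then have "s - r \<in> ?R" using that frag.subspace_diff[OF subspace_tensor_rel] by blast
      then have "r + (s - r) \<in> {r} + ?R" by (intro set_plus_intro) auto
      then show "s \<in> {r} + ?R" by simp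
    qed
  qed
  have singletons: "{x} + {y} = {x + y}" for x y :: "(complex \<times> ('k ^ 'n)) \<Rightarrow>\<^sub>0 int"
    by (simp add: set_plus_def)
  have \<Phi>_coset: "\<Phi> ({x} + ?R) = frag_value \<iota> x" for x
  proof -
    have "frag_value \<iota> ` ({x} + ?R) = {frag_value \<iota> x}"
      using R_0 by (auto simp: set_plus_def frag_value_add frag_value_tensor_rel image_iff)
    then show ?thesis by (simp add: \<Phi>_def)
  qed
  have add: "\<Phi> (X + Y) = \<Phi> X + \<Phi> Y" if XY: "X \<in> tensor_space \<iota> V" "Y \<in> tensor_space \<iota> V" for X Y
  proof -
    obtain x y where "X = {x} + ?R" "Y = {y} + ?R" using XY by (auto simp: tensor_space_def)
    moreover have "({x} + ?R) + ({y} + ?R) = ({x} + {y}) + (?R + ?R)" by (simp only: add_ac)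
    ultimately show ?thesis by (simp add: R_R singletons \<Phi>_coset frag_value_add)
  qed
  have scale: "\<Phi> (tensor_scale \<iota> V c X) = c *s \<Phi> X" if X: "X \<in> tensor_space \<iota> V" for c X
  proof -
    obtain x where x: "X = {x} + ?R" using X by (auto simp: tensor_space_def)
    \<comment> \<open>A one-point image suffices to evaluate \<open>\<Phi>\<close>;
      \<open>tensor_scale\<close> need not be rewritten as a coset.\<close>
    have "frag_value \<iota> ` tensor_scale \<iota> V c X = {c *s frag_value \<iota> x}"
    proof -
      have "frag_value \<iota> w = c *s frag_value \<iota> x" if "w \<in> tensor_scale \<iota> V c X" for w
        using that unfolding tensor_scale_def x
        by (auto simp: set_plus_def frag_value_add frag_value_scale frag_value_tensor_rel)
      moreover have "tensor_scale \<iota> V c X \<noteq> {}"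
        using R_0 by (auto simp: tensor_scale_def x set_plus_def)
      ultimately have "frag_value \<iota> ` tensor_scale \<iota> V c X \<subseteq> {c *s frag_value \<iota> x}"
        "frag_value \<iota> ` tensor_scale \<iota> V c X \<noteq> {}" by auto
      then show ?thesis by (metis subset_singletonD)
    qed
    then show ?thesis by (simp add: x \<Phi>_coset) (simp add: \<Phi>_def)
  qed
  have "inj_on \<Phi> (tensor_space \<iota> V)"
  proof (rule inj_onI)
    fix X Y assume XY: "X \<in> tensor_space \<iota> V" "Y \<in> tensor_space \<iota> V" "\<Phi> X = \<Phi> Y"
    then obtain x y where xy: "X = {x} + ?R" "Y = {y} + ?R" "x \<in> tensor_free V" "y \<in> tensor_free V"
      by (auto simp: tensor_space_def)
    have "x - y \<in> tensor_free V"
      using xy(3,4) keys_diff[of x y] by (auto simp: tensor_free_def)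
    moreover have "frag_value \<iota> (x - y) = 0"
      using XY(3) by (simp add: xy \<Phi>_coset frag_value_diff)
    ultimately have "x - y \<in> ?R" using V by (intro frag_value_eq_0_imp_tensor_rel)
    have "X = {y} + ({x - y} + ?R)" by (simp add: xy singletons flip: add.assoc)
    then show "X = Y" by (simp add: coset_R[OF \<open>x - y \<in> ?R\<close>] xy)
  qed
  moreover have "\<Phi> ` tensor_space \<iota> V = vec.span (vec_map \<iota> ` V)"
    by (simp add: tensor_space_def image_image \<Phi>_coset frag_value_image_tensor_free)
  ultimately have "bij_betw \<Phi> (tensor_space \<iota> V) (vec.span (vec_map \<iota> ` V))"
    by (simp add: bij_betw_def)
  with add scale show ?thesis unfolding iso_tensor_def by blast
qed

end


section \<open>Root spaces of a Jordan-Krylov basis\<close>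

lemma gen_eigenspace_eq:
  "gen_eigenspace M a = {v. \<exists>m. poly_mat ([:- a, 1:] ^ m) M *v v = 0}"
  by (simp add: gen_eigenspace_def poly_mat_power poly_mat_linear)

lemma subspace_gen_eigenspace: "vec.subspace (gen_eigenspace M a)"
  unfolding gen_eigenspace_eq vec.subspace_def
proof (intro conjI ballI allI)
  fix x y assume "x \<in> {v. \<exists>m. poly_mat ([:- a, 1:] ^ m) M *v v = 0}"
    "y \<in> {v. \<exists>m. poly_mat ([:- a, 1:] ^ m) M *v v = 0}"
  then obtain m k where "poly_mat ([:- a, 1:] ^ m) M *v x = 0" "poly_mat ([:- a, 1:] ^ k) M *v y = 0"
    by blast
  \<comment> \<open>The sum of the two exponents serves both vectors.\<close>
  then have "poly_mat ([:- a, 1:] ^ (m + k)) M *v x = 0" "poly_mat ([:- a, 1:] ^ (m + k)) M *v y = 0"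
    by (auto elim!: poly_mat_annihilator_mult simp: le_imp_power_dvd)
  then show "x + y \<in> {v. \<exists>m. poly_mat ([:- a, 1:] ^ m) M *v v = 0}"
    by (auto simp: matrix_vector_right_distrib intro!: exI[of _ "m + k"])
qed (auto simp: vec.scale)

lemma span_poly_mat_closed:
  assumes "\<And>s. s \<in> S \<Longrightarrow> M *v s \<in> vec.span S" "x \<in> vec.span S"
  shows "poly_mat q M *v x \<in> vec.span S"
proof -
  have "vec.subspace {x. M *v x \<in> vec.span S}"
    by (auto simp: vec.subspace_def matrix_vector_right_distrib vec.scale
        intro: vec.span_add vec.span_scale vec.span_zero)
  then have "vec.span S \<subseteq> {x. M *v x \<in> vec.span S}"
    using assms(1) by (intro vec.span_minimal) auto
  then have M: "M *v x \<in> vec.span S" if "x \<in> vec.span S" for x using that by blast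
  show ?thesis
  proof (induction q)
    case 0
    then show ?case by (simp add: vec.span_zero)
  next
    case (pCons a q)
    then show ?case
      using assms(2) M
      by (simp add: poly_mat_pCons matrix_vector_mult_add_rdistrib mat_vector_mult vec.span_add
          vec.span_scale flip: matrix_vector_mul_assoc)
  qed
qed

text \<open>The product formula lists the roots with multiplicity; that they are distinct is derived
  from irreducibility.\<close>

locale jordan_krylov_setting = scalar_extension \<iota> for \<iota> :: "'k::field \<Rightarrow> complex" +
  fixes A :: "'k ^ 'n ^ 'n" and f :: "'k poly" and \<alpha> :: "nat \<Rightarrow> complex" and \<B> :: "('k ^ 'n) set"
  assumes irred: "irreducible f"
    and roots: "map_poly \<iota> f = (\<Prod>i\<in>{1..degree f}. [:- \<alpha> i, 1:])"
    and basis: "jordan_krylov_basis A (ker_pow A f (ell_bar A f)) \<B>"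
    and nonzero: "0 \<notin> \<B>"
begin

abbreviation "A\<^sub>C \<equiv> mat_map \<iota> A"
abbreviation "F \<equiv> map_poly \<iota> f"
abbreviation "root_factor i \<equiv> [:- \<alpha> i, 1:]"
abbreviation "rk \<equiv> rank_f A f"
abbreviation "P i \<equiv> P_at \<iota> A f (\<alpha> i)"

text \<open>\<open>F\<close> divided by \<open>x - \<alpha> i\<close>, given as a product so that
  divisibility by the other root factors is visible.\<close>

definition cofactor :: "nat \<Rightarrow> complex poly" where
  "cofactor i = (\<Prod>j\<in>{1..degree f} - {i}. root_factor j)"

section \<open>Root factors and their cofactors\<close>

lemma F_split: "i \<in> {1..degree f} \<Longrightarrow> F = cofactor i * root_factor i"
  unfolding roots cofactor_def by (subst prod.remove[of _ i]) simp_all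

lemma poly_F_root: "i \<in> {1..degree f} \<Longrightarrow> poly F (\<alpha> i) = 0"
  by (simp add: F_split)

text \<open>In characteristic 0 an irreducible polynomial is coprime to its derivative, so its roots are
  simple.\<close>

lemma poly_cofactor_root:
  assumes i: "i \<in> {1..degree f}"
  shows "poly (cofactor i) (\<alpha> i) \<noteq> 0"
proof
  assume 0: "poly (cofactor i) (\<alpha> i) = 0"
  \<comment> \<open>By the product rule, this value is that of the cofactor.\<close>
  have "poly (pderiv F) (\<alpha> i) = 0"
    unfolding F_split[OF i] by (simp add: pderiv_mult pderiv_pCons 0 del: mult_pCons_right)
  moreover have pderiv_F: "map_poly \<iota> (pderiv f) = pderiv F"
    by (rule map_poly_hom_pderiv) unfold_locales
  have "pderiv F \<noteq> 0" using irreducible_degree_pos[OF irred] by (simp add: pderiv_eq_0_iff)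
  then have "pderiv f \<noteq> 0" using pderiv_F by auto
  \<comment> \<open>The degree is read off over \<open>complex\<close>, whose type carries
    characteristic 0.\<close>
  moreover have "degree (pderiv f) < degree f"
  proof -
    have "degree (pderiv f) = degree (map_poly \<iota> (pderiv f))" by simp
    also have "\<dots> = degree f - 1" by (simp only: pderiv_F degree_pderiv degree_map_poly_hom)
    finally show ?thesis using irreducible_degree_pos[OF irred] by linarith
  qed
  ultimately have "\<not> f dvd pderiv f" using dvd_imp_degree_le[of f "pderiv f"] by auto
  then obtain a b where "a * f + b * pderiv f = 1"
    using irreducible_imp_comaximal[OF irred] unfolding comaximal_def by blast
  then have "map_poly \<iota> (a * f + b * pderiv f) = 1" by simp
  then have "map_poly \<iota> a * F + map_poly \<iota> b * pderiv F = 1"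
    by (simp add: map_poly_hom_add map_poly_hom_mult pderiv_F)
  then have "poly (map_poly \<iota> a * F + map_poly \<iota> b * pderiv F) (\<alpha> i) = 1" by simp
  then show False
    using poly_F_root[OF i] \<open>poly (pderiv F) (\<alpha> i) = 0\<close> by simp
qed

text \<open>A coincidence would make the factor for \<open>j\<close> in \<open>cofactor i\<close>
  vanish at \<open>\<alpha> i\<close>.\<close>

lemma roots_distinct:
  assumes "i \<in> {1..degree f}" "j \<in> {1..degree f}" "i \<noteq> j"
  shows "\<alpha> i \<noteq> \<alpha> j"
  using poly_cofactor_root[OF assms(1)] assms by (auto simp: cofactor_def poly_prod)

lemma comaximal_root_cofactor:
  "i \<in> {1..degree f} \<Longrightarrow> comaximal (root_factor i ^ m) (cofactor i ^ k)"
  by (intro comaximal_power comaximal_linear poly_cofactor_root)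

text \<open>Substituting \<open>\<alpha> i\<close> for \<open>\<lambda>\<close> in
  \<open>psi_times\<close> removes \<open>f(\<lambda>)\<close>; then \<open>root_factor i\<close> is
  cancelled.\<close>

lemma map_poly_psi:
  assumes i: "i \<in> {1..degree f}"
  shows "map_poly (\<lambda>q. poly (map_poly \<iota> q) (\<alpha> i)) (psi f) = cofactor i"
proof -
  interpret ev: unital_ring_hom "\<lambda>q. poly (map_poly \<iota> q) (\<alpha> i)"
    by (rule unital_ring_hom_poly)
  let ?e = "map_poly (\<lambda>q. poly (map_poly \<iota> q) (\<alpha> i))"
  have "?e [:- [:0, 1:], 1:] = root_factor i"
    by (simp add: map_poly_pCons hom_minus)
  then have "?e (psi f) * root_factor i = ?e (psi f * [:- [:0, 1:], 1:])"
    by (simp only: ev.map_poly_hom_mult)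
  also have "\<dots> = ?e (map_poly (\<lambda>c. [:c:]) f) - ?e [:f:]"
    unfolding psi_times by (rule ev.map_poly_hom_diff)
  also have "?e [:f:] = 0"
    by (simp add: map_poly_pCons poly_F_root[OF i])
  also have "?e (map_poly (\<lambda>c. [:c:]) f) = F"
    by (rule poly_eqI) (simp add: coeff_map_poly map_poly_pCons)
  finally have "?e (psi f) * root_factor i = cofactor i * root_factor i"
    by (simp add: F_split[OF i])
  then show ?thesis by (simp only: mult_cancel_right) simp
qed

text \<open>Reduction modulo \<open>f\<close> does not change values at a root of \<open>f\<close>,
  and evaluation, being a ring homomorphism, commutes with the substitution of
  \<open>A\<close>.\<close>

lemma p_at_eq:
  assumes i: "i \<in> {1..degree f}"
  shows "p_at \<iota> A f k (\<alpha> i) u = poly_mat (cofactor i ^ k * F ^ (rk u - k)) A\<^sub>C *v vec_map \<iota> u"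
proof -
  interpret ev: unital_ring_hom "\<lambda>q. poly (map_poly \<iota> q) (\<alpha> i)"
    by (rule unital_ring_hom_poly)
  have ev_mod: "poly (map_poly \<iota> (c mod f)) (\<alpha> i) = poly (map_poly \<iota> c) (\<alpha> i)" for c
  proof -
    have "c = c div f * f + c mod f" by simp
    then have "map_poly \<iota> c = map_poly \<iota> (c div f) * F + map_poly \<iota> (c mod f)"
      by (metis map_poly_hom_add map_poly_hom_mult)
    then show ?thesis by (simp add: poly_F_root[OF i])
  qed
  have "map_poly (\<lambda>q. poly (map_poly \<iota> q) (\<alpha> i)) (psi_red f k)
      = map_poly (\<lambda>q. poly (map_poly \<iota> q) (\<alpha> i)) (psi f ^ k)"
    unfolding psi_red_def by (rule poly_eqI) (simp add: coeff_map_poly ev_mod)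
  also have "\<dots> = cofactor i ^ k"
    by (simp add: ev.map_poly_hom_power map_poly_psi[OF i])
  finally have psi: "map_poly (\<lambda>q. poly (map_poly \<iota> q) (\<alpha> i)) (psi_red f k) = cofactor i ^ k" .
  have mat: "mat_map (\<lambda>q. poly (map_poly \<iota> q) (\<alpha> i)) (mat_map (\<lambda>a. [:a:]) A) = A\<^sub>C"
    by (simp add: mat_map_def vec_eq_iff map_poly_pCons)
  have vec: "vec_map (\<lambda>q. poly (map_poly \<iota> q) (\<alpha> i)) (vec_map (\<lambda>a. [:a:]) v) = vec_map \<iota> v" for v
    by (simp add: vec_map_def vec_eq_iff map_poly_pCons)
  show ?thesis
    unfolding p_at_def p_vec_def ev.vec_map_hom_poly_mat psi mat vec
    by (simp add: vec_map_hom_poly_mat map_poly_hom_power poly_mat_mult_vec flip: poly_mat_power)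
qed

section \<open>Jordan chains from the basis vectors\<close>

lemma finite_basis: "finite \<B>"
  and ker_pow_eq_sum: "ker_pow A f (ell_bar A f) = (\<Sum>b\<in>\<B>. krylov A b)"
  and basis_direct: "direct_sum_condition \<B> (krylov A)"
  using basis by (simp_all add: jordan_krylov_basis_def)

lemma rank_basis:
  assumes "b \<in> \<B>"
  shows "1 \<le> rk b" "rk b \<le> ell_bar A f" "poly_mat (f ^ rk b) A *v b = 0"
    "poly_mat (f ^ (rk b - 1)) A *v b \<noteq> 0"
proof -
  have "b \<noteq> 0" "b \<in> ker_pow A f (ell_bar A f)"
    using assms basis nonzero by (auto simp: jordan_krylov_basis_def)
  then show "1 \<le> rk b" "rk b \<le> ell_bar A f" "poly_mat (f ^ rk b) A *v b = 0"
    "poly_mat (f ^ (rk b - 1)) A *v b \<noteq> 0"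
    by (rule rank_f_props)+
qed

lemma F_annihilates:
  assumes "b \<in> \<B>" "F ^ rk b dvd q"
  shows "poly_mat q A\<^sub>C *v vec_map \<iota> b = 0"
proof (rule poly_mat_annihilator_mult[OF _ assms(2)])
  show "poly_mat (F ^ rk b) A\<^sub>C *v vec_map \<iota> b = 0"
    using vec_map_hom_poly_mat[of "f ^ rk b" A b] rank_basis(3)[OF assms(1)]
    by (simp add: map_poly_hom_power)
qed

text \<open>\<open>root_factor i\<close> turns one \<open>cofactor i\<close> into \<open>F\<close>,
  which moves \<open>k\<close> to \<open>k - 1\<close>. At \<open>k = 1\<close> the result is
  \<open>F ^ rk b\<close>, which kills the image of \<open>b\<close>.\<close>

lemma p_at_step:
  assumes "i \<in> {1..degree f}" "b \<in> \<B>" "1 \<le> k" "k \<le> rk b"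
  shows "(A\<^sub>C - mat (\<alpha> i)) *v p_at \<iota> A f k (\<alpha> i) b
    = (if k = 1 then 0 else p_at \<iota> A f (k - 1) (\<alpha> i) b)"
proof -
  have "Suc (rk b - k) = rk b - (k - 1)" using assms(3,4) by simp
  then have F: "F ^ (rk b - (k - 1)) = F * F ^ (rk b - k)" by (metis power_Suc)
  have cof: "cofactor i ^ k = cofactor i * cofactor i ^ (k - 1)"
    using assms(3) by (metis Suc_diff_1 less_eq_Suc_le One_nat_def power_Suc)
  have "root_factor i * (cofactor i ^ k * F ^ (rk b - k))
      = cofactor i ^ (k - 1) * ((cofactor i * root_factor i) * F ^ (rk b - k))"
    by (simp only: cof mult_ac)
  also have "\<dots> = cofactor i ^ (k - 1) * F ^ (rk b - (k - 1))"
    unfolding F_split[OF assms(1), symmetric] F ..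
  finally have "(A\<^sub>C - mat (\<alpha> i)) *v p_at \<iota> A f k (\<alpha> i) b
      = poly_mat (cofactor i ^ (k - 1) * F ^ (rk b - (k - 1))) A\<^sub>C *v vec_map \<iota> b"
    unfolding p_at_eq[OF assms(1)] poly_mat_linear[symmetric] poly_mat_mult_vec[symmetric] by simp
  moreover have "\<dots> = 0" if "k = 1"
    using that by (intro F_annihilates[OF assms(2)]) simp
  ultimately show ?thesis by (simp add: p_at_eq[OF assms(1)])
qed

text \<open>The vector is \<open>cofactor i\<close> acting on the image of
  \<open>f(A)^(rk b - 1) b\<close>, a nonzero vector killed by \<open>f(A)\<close>; the cofactor has
  smaller degree than \<open>f\<close>.\<close>

lemma p_at_1_neq_0:
  assumes i: "i \<in> {1..degree f}" and b: "b \<in> \<B>"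
  shows "p_at \<iota> A f 1 (\<alpha> i) b \<noteq> 0"
proof -
  let ?v = "poly_mat (f ^ (rk b - 1)) A *v b"
  have "f ^ rk b = f * f ^ (rk b - 1)" using rank_basis(1)[OF b] by (simp add: power_eq_if)
  then have "poly_mat f A *v ?v = 0" using rank_basis(3)[OF b] by (simp flip: poly_mat_mult_vec)
  moreover have "cofactor i \<noteq> 0" using poly_cofactor_root[OF i] by auto
  moreover have "degree (cofactor i) < degree f"
  proof -
    have "degree F = degree (cofactor i) + degree (root_factor i)"
      unfolding F_split[OF i] using \<open>cofactor i \<noteq> 0\<close> by (intro degree_mult_eq) auto
    then show ?thesis by simp
  qed
  ultimately have "poly_mat (cofactor i) A\<^sub>C *v vec_map \<iota> ?v \<noteq> 0"
    using irred rank_basis(4)[OF b] by (intro poly_mat_extension_neq_0)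
  then show ?thesis
    by (simp add: p_at_eq[OF i] poly_mat_mult_vec vec_map_hom_poly_mat map_poly_hom_power)
qed

text \<open>One inclusion takes the missing cofactors from \<open>F ^ (rk b - k)\<close>. For the
  other, the span is invariant under \<open>A\<^sub>C\<close> by the chain property and contains the
  top vector, which generates the right-hand side.\<close>

lemma P_eq:
  assumes i: "i \<in> {1..degree f}" and b: "b \<in> \<B>"
  shows "P i b = range (\<lambda>q. poly_mat (q * cofactor i ^ rk b) A\<^sub>C *v vec_map \<iota> b)"
proof
  let ?S = "(\<lambda>k. p_at \<iota> A f k (\<alpha> i) b) ` {1..rk b}"
  have "p_at \<iota> A f k (\<alpha> i) b \<in> range (\<lambda>q. poly_mat (q * cofactor i ^ rk b) A\<^sub>C *v vec_map \<iota> b)"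
    if "k \<in> {1..rk b}" for k
  proof -
    have "cofactor i ^ k * F ^ (rk b - k)
        = root_factor i ^ (rk b - k) * (cofactor i ^ k * cofactor i ^ (rk b - k))"
      unfolding F_split[OF i] power_mult_distrib by (simp only: mult_ac)
    also have "cofactor i ^ k * cofactor i ^ (rk b - k) = cofactor i ^ rk b"
      using that by (simp flip: power_add)
    finally show ?thesis by (simp add: p_at_eq[OF i])
  qed
  then show "P i b \<subseteq> range (\<lambda>q. poly_mat (q * cofactor i ^ rk b) A\<^sub>C *v vec_map \<iota> b)"
    unfolding P_at_def by (intro vec.span_minimal subspace_poly_mat_multiples) auto
  have "A\<^sub>C *v s \<in> vec.span ?S" if "s \<in> ?S" for s
  proof -
    from that obtain k where k: "s = p_at \<iota> A f k (\<alpha> i) b" "1 \<le> k" "k \<le> rk b" by auto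
    have "(A\<^sub>C - mat (\<alpha> i)) *v s \<in> vec.span ?S"
      unfolding k(1) p_at_step[OF i b k(2,3)] using k(2,3)
      by (auto simp: vec.span_zero intro!: vec.span_base imageI)
    moreover have "\<alpha> i *s s \<in> vec.span ?S" using that by (intro vec.span_scale vec.span_base)
    ultimately have "(A\<^sub>C - mat (\<alpha> i)) *v s + \<alpha> i *s s \<in> vec.span ?S" by (rule vec.span_add)
    then show ?thesis by (simp add: matrix_vector_mult_diff_rdistrib mat_vector_mult)
  qed
  moreover have "p_at \<iota> A f (rk b) (\<alpha> i) b \<in> vec.span ?S"
    using rank_basis(1)[OF b] by (intro vec.span_base imageI) simp
  ultimately have "poly_mat q A\<^sub>C *v p_at \<iota> A f (rk b) (\<alpha> i) b \<in> vec.span ?S" for q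
    by (rule span_poly_mat_closed)
  then show "range (\<lambda>q. poly_mat (q * cofactor i ^ rk b) A\<^sub>C *v vec_map \<iota> b) \<subseteq> P i b"
    by (auto simp: p_at_eq[OF i] P_at_def poly_mat_mult_vec)
qed

lemma subspace_P: "vec.subspace (P i b)"
  by (simp add: P_at_def)

text \<open>On a multiple of \<open>cofactor i ^ rk b\<close>, the power of
  \<open>root_factor i\<close> completes \<open>F ^ rk b\<close>.\<close>

lemma root_factor_annihilates_P:
  assumes "i \<in> {1..degree f}" "b \<in> \<B>" "x \<in> P i b" "root_factor i ^ rk b dvd q"
  shows "poly_mat q A\<^sub>C *v x = 0"
proof (rule poly_mat_annihilator_mult[OF _ assms(4)])
  obtain r where x: "x = poly_mat (r * cofactor i ^ rk b) A\<^sub>C *v vec_map \<iota> b"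
    using assms(3) unfolding P_eq[OF assms(1,2)] by blast
  have eq: "root_factor i ^ rk b * (r * cofactor i ^ rk b) = r * F ^ rk b"
    unfolding F_split[OF assms(1)] power_mult_distrib by (simp only: mult_ac)
  show "poly_mat (root_factor i ^ rk b) A\<^sub>C *v x = 0"
    unfolding x poly_mat_mult_vec[symmetric] eq by (rule F_annihilates[OF assms(2)]) simp
qed

lemma P_subset_krylov:
  "i \<in> {1..degree f} \<Longrightarrow> b \<in> \<B> \<Longrightarrow> P i b \<subseteq> krylov A\<^sub>C (vec_map \<iota> b)"
  by (auto simp: P_eq krylov_eq)

lemma P_subset_gen_eigenspace:
  "i \<in> {1..degree f} \<Longrightarrow> b \<in> \<B> \<Longrightarrow> P i b \<subseteq> gen_eigenspace A\<^sub>C (\<alpha> i)"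
  using root_factor_annihilates_P[OF _ _ _ dvd_refl] by (auto simp: gen_eigenspace_eq)

text \<open>Writing the minimal polynomial as \<open>f\<^bsup>l\<^esup> g\<close> with \<open>g\<close> coprime to \<open>f\<close>, a Bezout relation yields a
  projection onto \<open>ker f(A)\<^bsup>l\<^esup>\<close> defined over \<open>K\<close>, which reproduces \<open>x\<close>.\<close>

lemma gen_eigenspace_subset_span:
  assumes i: "i \<in> {1..degree f}"
  shows "gen_eigenspace A\<^sub>C (\<alpha> i) \<subseteq> vec.span (vec_map \<iota> ` ker_pow A f (ell_bar A f))"
proof
  fix x assume "x \<in> gen_eigenspace A\<^sub>C (\<alpha> i)"
  then obtain m where m: "poly_mat (root_factor i ^ m) A\<^sub>C *v x = 0" by (auto simp: gen_eigenspace_eq)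
  let ?l = "ell_bar A f"
  obtain g where g: "minpoly A = f ^ ?l * g" "\<not> f dvd g" using minpoly_split[OF irred] by blast
  have fg: "comaximal f g" by (rule irreducible_imp_comaximal[OF irred g(2)])
  then obtain a b where "a * f + b * g = 1" by (auto simp: comaximal_def)
  then have "map_poly \<iota> (a * f + b * g) = 1" by simp
  then have "map_poly \<iota> a * F + map_poly \<iota> b * map_poly \<iota> g = 1"
    by (simp add: map_poly_hom_add map_poly_hom_mult)
  then have "poly (map_poly \<iota> a * F + map_poly \<iota> b * map_poly \<iota> g) (\<alpha> i) = 1" by simp
  \<comment> \<open>\<open>F\<close> vanishes at \<open>\<alpha> i\<close>, so the Bezout relation
    makes the value of \<open>g\<close> a unit.\<close>
  then have "poly (map_poly \<iota> g) (\<alpha> i) \<noteq> 0" using poly_F_root[OF i] by auto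
  then have root_g: "comaximal (root_factor i ^ m) (map_poly \<iota> g)"
    using comaximal_power[of _ _ m 1] comaximal_linear by fastforce
  have "poly_mat (F ^ ?l * map_poly \<iota> g) A\<^sub>C = mat_map \<iota> (poly_mat (minpoly A) A)"
    by (simp add: g(1) mat_map_hom_poly_mat map_poly_hom_mult map_poly_hom_power)
  also have "\<dots> = 0" by (simp add: minpoly_props(2)) (simp add: mat_map_def vec_eq_iff)
  finally have annihilate: "poly_mat (F ^ ?l * map_poly \<iota> g) A\<^sub>C *v x = 0" by simp
  \<comment> \<open>The left-hand vector is killed by two comaximal polynomials, a power of the root
    factor and \<open>g\<close>.\<close>
  have "poly_mat (F ^ ?l) A\<^sub>C *v x = 0"
  proof (rule comaximal_annihilate[OF root_g])
    show "poly_mat (root_factor i ^ m) A\<^sub>C *v (poly_mat (F ^ ?l) A\<^sub>C *v x) = 0"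
      using poly_mat_annihilator_mult[OF m, of "root_factor i ^ m * F ^ ?l"]
      by (simp only: poly_mat_mult_vec dvd_triv_left)
    show "poly_mat (map_poly \<iota> g) A\<^sub>C *v (poly_mat (F ^ ?l) A\<^sub>C *v x) = 0"
      using annihilate by (simp only: mult.commute[of "F ^ ?l"] poly_mat_mult_vec)
  qed
  moreover have "comaximal (f ^ ?l) g" using comaximal_power[OF fg, of ?l 1] by simp
  then obtain c d where cd: "c * f ^ ?l + d * g = 1" by (auto simp: comaximal_def)
  then have "map_poly \<iota> (c * f ^ ?l + d * g) = 1" by simp
  then have "map_poly \<iota> c * F ^ ?l + map_poly \<iota> (d * g) = 1"
    by (simp add: map_poly_hom_add map_poly_hom_mult map_poly_hom_power)
  then have "x = poly_mat (map_poly \<iota> c * F ^ ?l + map_poly \<iota> (d * g)) A\<^sub>C *v x" by simp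
  ultimately have "x = poly_mat (map_poly \<iota> (d * g)) A\<^sub>C *v x"
    by (simp add: poly_mat_add_vec poly_mat_mult_vec)
  also have "\<dots> = poly_mat (map_poly \<iota> (d * g)) A\<^sub>C *v (\<Sum>j\<in>UNIV. x $ j *s axis j 1)"
    by (simp add: basis_expansion)
  \<comment> \<open>The standard basis is defined over \<open>K\<close>, so only the coordinates of
    \<open>x\<close> are complex.\<close>
  also have "\<dots> = (\<Sum>j\<in>UNIV. x $ j *s vec_map \<iota> (poly_mat (d * g) A *v axis j 1))"
  proof -
    have "vec_map \<iota> (axis j 1) = axis j 1" for j :: 'n
      by (simp add: vec_map_def axis_def vec_eq_iff)
    then show ?thesis by (simp add: vec.sum vec.scale vec_map_hom_poly_mat)
  qed
  also have "\<dots> \<in> vec.span (vec_map \<iota> ` ker_pow A f ?l)"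
  proof (intro vec.span_sum vec.span_scale vec.span_base imageI)
    fix j :: 'n
    have "f ^ ?l * (d * g) = d * minpoly A" by (simp only: g(1) mult_ac)
    then show "poly_mat (d * g) A *v axis j 1 \<in> ker_pow A f ?l"
      by (simp only: ker_pow_eq mem_Collect_eq flip: poly_mat_mult_vec)
         (simp add: poly_mat_mult minpoly_props(2))
  qed
  finally show "x \<in> vec.span (vec_map \<iota> ` ker_pow A f ?l)" .
qed

section \<open>Direct sums and the generalized eigenspace\<close>

lemma span_ker_pow_eq_sum:
  "vec.span (vec_map \<iota> ` ker_pow A f (ell_bar A f)) = (\<Sum>b\<in>\<B>. krylov A\<^sub>C (vec_map \<iota> b))"
  by (rule span_image_eq_sum_krylov[OF finite_basis ker_pow_eq_sum])

lemma direct_sum_krylov: "direct_sum_condition \<B> (\<lambda>b. krylov A\<^sub>C (vec_map \<iota> b))"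
  by (rule direct_sum_krylov_extension[OF finite_basis basis_direct])

lemma direct_sum_P:
  assumes "i \<in> {1..degree f}" "C \<subseteq> \<B>"
  shows "direct_sum_condition C (P i)"
  using direct_sum_krylov finite_basis assms(2)
proof (rule direct_sum_condition_mono)
  show "0 \<in> krylov A\<^sub>C (vec_map \<iota> b)" for b by (rule vec.subspace_0[OF subspace_krylov])
  show "0 \<in> P i b" for b by (rule vec.subspace_0[OF subspace_P])
qed (use P_subset_krylov assms in blast)

text \<open>For the harder inclusion, decompose \<open>x\<close> along the Krylov spaces and apply a
  multiple of \<open>cofactor i ^ ell_bar A f\<close> that fixes \<open>x\<close>. As ranks are at
  most \<open>ell_bar A f\<close>, it carries each component into \<open>P i b\<close>.\<close>

lemma sum_P_eq_gen_eigenspace: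
  assumes i: "i \<in> {1..degree f}"
  shows "(\<Sum>b\<in>\<B>. P i b) = gen_eigenspace A\<^sub>C (\<alpha> i)"
proof
  show "(\<Sum>b\<in>\<B>. P i b) \<subseteq> gen_eigenspace A\<^sub>C (\<alpha> i)"
    by (intro sum_sets_subset_subspace finite_basis subspace_gen_eigenspace
        P_subset_gen_eigenspace i)
  show "gen_eigenspace A\<^sub>C (\<alpha> i) \<subseteq> (\<Sum>b\<in>\<B>. P i b)"
  proof
    fix x assume x: "x \<in> gen_eigenspace A\<^sub>C (\<alpha> i)"
    let ?l = "ell_bar A f"
    have "x \<in> (\<Sum>b\<in>\<B>. krylov A\<^sub>C (vec_map \<iota> b))"
      using gen_eigenspace_subset_span[OF i] x unfolding span_ker_pow_eq_sum by blast
    then obtain s where s: "x = sum s \<B>" "\<forall>b\<in>\<B>. s b \<in> krylov A\<^sub>C (vec_map \<iota> b)"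
      unfolding set_sum_alt[OF finite_basis] by blast
    from x obtain m where "poly_mat (root_factor i ^ m) A\<^sub>C *v x = 0"
      by (auto simp: gen_eigenspace_eq)
    then obtain c where "poly_mat (c * cofactor i ^ ?l) A\<^sub>C *v x = x"
      by (rule comaximal_reproduce[OF comaximal_root_cofactor[OF i]])
    then have "x = (\<Sum>b\<in>\<B>. poly_mat (c * cofactor i ^ ?l) A\<^sub>C *v s b)"
      by (simp add: s(1) vec.sum)
    moreover have "poly_mat (c * cofactor i ^ ?l) A\<^sub>C *v s b \<in> P i b" if b: "b \<in> \<B>" for b
    proof -
      obtain q where q: "s b = poly_mat q A\<^sub>C *v vec_map \<iota> b"
        using s(2) b unfolding krylov_eq by blast
      have "cofactor i ^ ?l = cofactor i ^ (?l - rk b) * cofactor i ^ rk b"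
        using rank_basis(2)[OF b] by (simp flip: power_add)
      then have eq: "c * cofactor i ^ ?l * q = (c * q * cofactor i ^ (?l - rk b)) * cofactor i ^ rk b"
        by (simp only: mult_ac)
      show ?thesis
        unfolding q poly_mat_mult_vec[symmetric] P_eq[OF i b] eq by (rule rangeI)
    qed
    ultimately show "x \<in> (\<Sum>b\<in>\<B>. P i b)"
      unfolding set_sum_alt[OF finite_basis] by blast
  qed
qed

lemma jordan_chain_p_at:
  assumes "i \<in> {1..degree f}" "b \<in> \<B>"
  shows "jordan_chain A\<^sub>C (\<alpha> i) (rk b) (\<lambda>k. p_at \<iota> A f k (\<alpha> i) b)"
  unfolding jordan_chain_def
  using p_at_1_neq_0[OF assms] p_at_step[OF assms] rank_basis(1)[OF assms(2)] by auto

lemma sum_P_rank_eq_span_chains: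
  assumes "i \<in> {1..degree f}"
  shows "\<exists>C. (\<forall>x\<in>C. jordan_chain A\<^sub>C (\<alpha> i) l x) \<and>
    (\<Sum>b\<in>{b \<in> \<B>. rk b = l}. P i b) = vec.span (\<Union>x\<in>C. x ` {1..l})"
proof (intro exI conjI)
  \<comment> \<open>One chain for each basis vector of rank \<open>l\<close>; without such vectors
    both sides are \<open>{0}\<close>.\<close>
  let ?C = "(\<lambda>b k. p_at \<iota> A f k (\<alpha> i) b) ` {b \<in> \<B>. rk b = l}"
  show "\<forall>x\<in>?C. jordan_chain A\<^sub>C (\<alpha> i) l x" using jordan_chain_p_at[OF assms] by auto
  have "(\<Sum>b\<in>{b \<in> \<B>. rk b = l}. P i b)
      = vec.span (\<Union>b\<in>{b \<in> \<B>. rk b = l}. (\<lambda>k. p_at \<iota> A f k (\<alpha> i) b) ` {1..rk b})"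
    unfolding P_at_def by (rule sum_span) (simp add: finite_basis)
  also have "(\<Union>b\<in>{b \<in> \<B>. rk b = l}. (\<lambda>k. p_at \<iota> A f k (\<alpha> i) b) ` {1..rk b})
      = (\<Union>x\<in>?C. x ` {1..l})" by auto
  finally show "(\<Sum>b\<in>{b \<in> \<B>. rk b = l}. P i b) = vec.span (\<Union>x\<in>?C. x ` {1..l})" .
qed

text \<open>\<open>cofactor i ^ rk b\<close> kills the spaces of all other roots, the comaximal
  \<open>root_factor i ^ rk b\<close> kills \<open>P i b\<close>.\<close>

lemma direct_sum_P_roots:
  assumes b: "b \<in> \<B>"
  shows "direct_sum_condition {1..degree f} (\<lambda>i. P i b)"
  unfolding direct_sum_condition_def
proof
  fix i assume i: "i \<in> {1..degree f}"
  have "(\<Sum>j\<in>{1..degree f} - {i}. P j b) \<subseteq> {x. poly_mat (cofactor i ^ rk b) A\<^sub>C *v x = 0}"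
  proof (intro sum_sets_subset_subspace subspace_kernel)
    fix j assume j: "j \<in> {1..degree f} - {i}"
    then have "root_factor j dvd cofactor i" by (auto simp: cofactor_def intro: dvd_prodI)
    then have "root_factor j ^ rk b dvd cofactor i ^ rk b" by (rule dvd_power_same)
    then show "P j b \<subseteq> {x. poly_mat (cofactor i ^ rk b) A\<^sub>C *v x = 0}"
      using root_factor_annihilates_P[of j b] j b by auto
  qed simp
  moreover have "P i b \<subseteq> {x. poly_mat (root_factor i ^ rk b) A\<^sub>C *v x = 0}"
    using root_factor_annihilates_P[OF i b _ dvd_refl] by blast
  moreover have "0 \<in> (\<Sum>j\<in>{1..degree f} - {i}. P j b)" "0 \<in> P i b"
    by (intro vec.subspace_0 subspace_sum_sets subspace_P)+
  ultimately show "(\<Sum>j\<in>{1..degree f} - {i}. P j b) \<inter> P i b = {0}"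
    using comaximal_annihilate[OF comaximal_root_cofactor[OF i]] by blast
qed

text \<open>A partition of unity from the pairwise comaximal powers of the root factors splits every
  \<open>q\<close> into multiples of the \<open>cofactor i ^ rk b\<close>.\<close>

lemma P_sum_eq_krylov:
  assumes b: "b \<in> \<B>"
  shows "P_sum \<iota> A f \<alpha> b = krylov A\<^sub>C (vec_map \<iota> b)"
  unfolding P_sum_def
proof
  show "(\<Sum>i\<in>{1..degree f}. P i b) \<subseteq> krylov A\<^sub>C (vec_map \<iota> b)"
    by (intro sum_sets_subset_subspace subspace_krylov P_subset_krylov b) auto
  show "krylov A\<^sub>C (vec_map \<iota> b) \<subseteq> (\<Sum>i\<in>{1..degree f}. P i b)"
  proof
    fix x assume "x \<in> krylov A\<^sub>C (vec_map \<iota> b)"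
    then obtain q where q: "x = poly_mat q A\<^sub>C *v vec_map \<iota> b" unfolding krylov_eq by blast
    have "comaximal (root_factor i ^ rk b) (root_factor j ^ rk b)"
      if "i \<in> {1..degree f}" "j \<in> {1..degree f}" "i \<noteq> j" for i j
      using roots_distinct[OF that] by (intro comaximal_power comaximal_linear) auto
    then obtain s where
      "(\<Sum>i\<in>{1..degree f}. s i * (\<Prod>j\<in>{1..degree f} - {i}. root_factor j ^ rk b)) = 1"
      using comaximal_partition_of_unity[of "{1..degree f}" "\<lambda>i. root_factor i ^ rk b"]
        irreducible_degree_pos[OF irred] by fastforce
    then have s: "(\<Sum>i\<in>{1..degree f}. s i * cofactor i ^ rk b) = 1"
      by (simp only: cofactor_def prod_power_distrib)
    have "q * 1 = (\<Sum>i\<in>{1..degree f}. (q * s i) * cofactor i ^ rk b)"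
      unfolding s[symmetric] by (simp only: sum_distrib_left mult.assoc)
    then have q_eq: "(\<Sum>i\<in>{1..degree f}. (q * s i) * cofactor i ^ rk b) = q" by simp
    have "x = (\<Sum>i\<in>{1..degree f}. poly_mat ((q * s i) * cofactor i ^ rk b) A\<^sub>C) *v vec_map \<iota> b"
      by (simp only: q_eq q flip: poly_mat_sum)
    also have "\<dots> = (\<Sum>i\<in>{1..degree f}. poly_mat ((q * s i) * cofactor i ^ rk b) A\<^sub>C *v vec_map \<iota> b)"
      by (rule matrix_sum_vector)
    finally have "x = (\<Sum>i\<in>{1..degree f}. poly_mat ((q * s i) * cofactor i ^ rk b) A\<^sub>C *v vec_map \<iota> b)" .
    moreover have "\<forall>i\<in>{1..degree f}. poly_mat ((q * s i) * cofactor i ^ rk b) A\<^sub>C *v vec_map \<iota> b \<in> P i b"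
      using P_eq[OF _ b] by blast
    ultimately show "x \<in> (\<Sum>i\<in>{1..degree f}. P i b)"
      unfolding set_sum_alt[OF finite_atLeastAtMost] by blast
  qed
qed

lemma direct_sum_P_sum: "direct_sum_condition \<B> (P_sum \<iota> A f \<alpha>)"
  using direct_sum_krylov finite_basis subset_refl
  by (rule direct_sum_condition_mono)
     (simp_all add: P_sum_eq_krylov vec.subspace_0 subspace_krylov)

text \<open>The sum is the complex span of the image of the kernel, with which the multiplication
  map identifies the tensor product.\<close>

lemma iso_tensor_sum_P_sum:
  "iso_tensor \<iota> (\<Sum>b\<in>\<B>. P_sum \<iota> A f \<alpha> b) (ker_pow A f (ell_bar A f))"
proof -
  have "(\<Sum>b\<in>\<B>. P_sum \<iota> A f \<alpha> b) = vec.span (vec_map \<iota> ` ker_pow A f (ell_bar A f))"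
    unfolding span_ker_pow_eq_sum by (rule sum.cong) (simp_all add: P_sum_eq_krylov)
  moreover have "vec.subspace (ker_pow A f (ell_bar A f))"
    unfolding ker_pow_def by (rule subspace_kernel)
  ultimately show ?thesis using iso_tensor_span by metis
qed

end

text \<open>Sums of sets do not express directness, so each direct sum contributes a separate
  \<open>direct_sum_condition\<close>.\<close>

theorem theorem14:
  fixes \<iota> :: "'k::field \<Rightarrow> complex"
    and A :: "'k ^ 'n ^ 'n"
    and f :: "'k poly"
    and \<alpha> :: "nat \<Rightarrow> complex"
    and \<B> :: "('k ^ 'n) set"
  assumes "field_embedding \<iota>"
    and "lead_coeff f = 1"
    and "irreducible f"
    and "f dvd charpoly A"
    and "map_poly \<iota> f = (\<Prod>i\<in>{1..degree f}. [:- \<alpha> i, 1:])"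
    and "jordan_krylov_basis A (ker_pow A f (ell_bar A f)) \<B>"
    and "0 \<notin> \<B>"
  shows "(\<forall>i\<in>{1..degree f}.
           (\<forall>l\<in>{1..ell_bar A f}.
              direct_sum_condition {b \<in> \<B>. rank_f A f b = l} (P_at \<iota> A f (\<alpha> i)) \<and>
              (\<exists>C. (\<forall>x\<in>C. jordan_chain (mat_map \<iota> A) (\<alpha> i) l x) \<and>
                 (\<Sum>b\<in>{b \<in> \<B>. rank_f A f b = l}. P_at \<iota> A f (\<alpha> i) b) =
                   vec.span (\<Union>x\<in>C. x ` {1..l}))) \<and>
           direct_sum_condition \<B> (P_at \<iota> A f (\<alpha> i)) \<and>
           (\<Sum>b\<in>\<B>. P_at \<iota> A f (\<alpha> i) b) = gen_eigenspace (mat_map \<iota> A) (\<alpha> i)) \<and>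
         (\<forall>b\<in>\<B>. direct_sum_condition {1..degree f} (\<lambda>i. P_at \<iota> A f (\<alpha> i) b)) \<and>
         direct_sum_condition \<B> (P_sum \<iota> A f \<alpha>) \<and>
         iso_tensor \<iota> (\<Sum>b\<in>\<B>. P_sum \<iota> A f \<alpha> b) (ker_pow A f (ell_bar A f))"
proof -
  interpret jordan_krylov_setting \<iota> A f \<alpha> \<B>
    using assms by unfold_locales (auto simp: field_embedding_def)
  show ?thesis
    using direct_sum_P sum_P_rank_eq_span_chains sum_P_eq_gen_eigenspace
        direct_sum_P_roots direct_sum_P_sum iso_tensor_sum_P_sum
    by (intro conjI ballI) auto
qed

end
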